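(* Let $G$ be a graph on $[n]$ such that $\mathcal E_G$ is finite-dimensional, and let $d_0$ be the largest $d$ with $\mathcal E_G^d\neq 0$. Then: (a) $\mathcal E_G^{d_0}$ is one-dimensional, spanned by a monomial $w_0^G$ (a product of generators $x_{ij}$ with $\{i,j\}\in G$); (b) for every $Q\in\mathcal E_G$ there exists $p^\vee\in\mathcal E_n^\vee$ with $Q=p^\vee * w_0^G$; (c) for every nonzero $Q\in\mathcal E_G$ there is a monomial $P\in\mathcal E_G$ with $PQ=w_0^G$ (up to a nonzero scalar, i.e. $PQ$ is a nonzero multiple of $w_0^G$); (d) the Hilbert series is palindromic: $\dim\mathcal E_G^d=\dim\mathcal E_G^{d_0-d}$ for all $0\le d\le d_0$; (e) for any expression of $w_0^G$ as a product of generators $p_1\cdots p_{d_0}$, the subwords $p_{i_1}\cdots p_{i_k}$ ($i_1<\dots<i_k$) span $\mathcal E_G$; (f) $\operatorname{rev}(w_0^G)=\pm w_0^G$.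
   Context: Let $n\ge 1$. The Fomin–Kirillov algebra $\mathcal E_n$ is the associative $\mathbb Q$-algebra with generators $x_{ij}$ for ordered pairs of distinct $i,j\in[n]$, subject to $x_{ij}=-x_{ji}$, $x_{ij}^2=0$, $x_{ij}x_{kl}=x_{kl}x_{ij}$ for distinct $i,j,k,l$, and $x_{ij}x_{jk}+x_{jk}x_{ki}+x_{ki}x_{ij}=0$ for distinct $i,j,k$. It is graded by degree (each $x_{ij}$ of degree 1); $\mathcal E_n^d$ is the degree-$d$ part. For a simple graph $G$ on vertex set $[n]$, $\mathcal E_G$ is the subalgebra of $\mathcal E_n$ generated by the $x_{ij}$ with $\{i,j\}$ an edge of $G$; $\mathcal E_G^d$ is its degree-$d$ part and $\mathcal E_G^+=\bigoplus_{d\ge1}\mathcal E_G^d$. $\mathcal E_n$ is also graded by $S_n$: the $S_n$-degree of $x_{ij}$ is the transposition $(i\,j)$, extended multiplicatively to monomials; $\sigma_P$ denotes the $S_n$-degree of an $S_n$-homogeneous $P$. $S_n$ acts by algebra automorphisms via $\sigma(x_{ij})=x_{\sigma(i)\sigma(j)}$. Equip $\mathcal E_n\otimes\mathcal E_n$ with the braided product $(P_1\otimes Q_1)(P_2\otimes Q_2)=P_1\sigma_{Q_1}(P_2)\otimes Q_1Q_2$ for $S_n$-homogeneous $Q_1$. The coproduct $\Delta:\mathcal E_n\to\mathcal E_n\otimes\mathcal E_n$ is the (well-defined) map multiplicative for this product with $\Delta(x_{ij})=x_{ij}\otimes1+1\otimes x_{ij}$. Let $\mathcal E_n^\vee=\bigoplus_d(\mathcal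 E_n^d)^*$ be the graded dual; for $p^\vee\in\mathcal E_n^\vee$ and $Q\in\mathcal E_n$ with $\Delta(Q)=\sum_k Q^k_{(1)}\otimes Q^k_{(2)}$, set $p^\vee*Q=\sum_k p^\vee(Q^k_{(1)})\,Q^k_{(2)}$. The map $\operatorname{rev}$ is the linear antiautomorphism of $\mathcal E_n$ reversing the order of the factors in every monomial. *)

theory Defs
  imports Complex_Main "HOL-Library.Function_Algebras"
begin

text \<open>Fomin--Kirillov algebra, realised through the free associative algebra over the
rationals on generators x_ij, ij ordered pairs of distinct elements of 1..n.
An element of the free algebra is a coefficient function on words (lists of generators);
E_n is the quotient by the two-sided ideal FK_ideal n, and we work with representatives.\<close>

type_synonym gen = "nat \<times> nat"
type_synonym word = "gen list"
type_synonym nc = "word \<Rightarrow> rat"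

definition scl :: "rat \<Rightarrow> nc \<Rightarrow> nc" where
  "scl c f = (\<lambda>w. c * f w)"

interpretation nc: vector_space scl
  by unfold_locales (auto simp: scl_def fun_eq_iff algebra_simps)

definition monom :: "word \<Rightarrow> nc" where
  "monom w = (\<lambda>u. if u = w then 1 else 0)"

definition ncmul :: "nc \<Rightarrow> nc \<Rightarrow> nc" where
  "ncmul P Q = (\<lambda>w. \<Sum>k\<in>{0..length w}. P (take k w) * Q (drop k w))"

definition gens :: "nat \<Rightarrow> gen set" where
  "gens n = {(i, j). i \<in> {1..n} \<and> j \<in> {1..n} \<and> i \<noteq> j}"

definition x :: "nat \<Rightarrow> nat \<Rightarrow> nc" where
  "x i j = monom [(i, j)]"

definition FK_relators :: "nat \<Rightarrow> nc set" where
  "FK_relators n =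
     {x i j + x j i | i j. (i, j) \<in> gens n}
   \<union> {ncmul (x i j) (x i j) | i j. (i, j) \<in> gens n}
   \<union> {ncmul (x i j) (x k l) - ncmul (x k l) (x i j) | i j k l.
        i \<in> {1..n} \<and> j \<in> {1..n} \<and> k \<in> {1..n} \<and> l \<in> {1..n} \<and> distinct [i, j, k, l]}
   \<union> {ncmul (x i j) (x j k) + ncmul (x j k) (x k i) + ncmul (x k i) (x i j) | i j k.
        i \<in> {1..n} \<and> j \<in> {1..n} \<and> k \<in> {1..n} \<and> distinct [i, j, k]}"

definition FK_ideal :: "nat \<Rightarrow> nc set" where
  "FK_ideal n = nc.span {ncmul (ncmul (monom u) r) (monom v) | u r v.
                          set u \<subseteq> gens n \<and> r \<in> FK_relators n \<and> set v \<subseteq> gens n}"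

definition simple_graph_on :: "nat \<Rightarrow> gen set \<Rightarrow> bool" where
  "simple_graph_on n E \<longleftrightarrow> E \<subseteq> gens n \<and> (\<forall>i j. (i, j) \<in> E \<longrightarrow> (j, i) \<in> E)"

definition EG :: "gen set \<Rightarrow> nc set" where
  "EG E = nc.span {monom w | w. set w \<subseteq> E}"

definition EGd :: "gen set \<Rightarrow> nat \<Rightarrow> nc set" where
  "EGd E d = nc.span {monom w | w. set w \<subseteq> E \<and> length w = d}"

text \<open>dim E_G^d = dim of the image of EGd E d in the quotient E_n\<close>
definition dimEG :: "nat \<Rightarrow> gen set \<Rightarrow> nat \<Rightarrow> nat" where
  "dimEG n E d = nc.dim (EGd E d) - nc.dim (EGd E d \<inter> FK_ideal n)"

definition EG_findim :: "nat \<Rightarrow> gen set \<Rightarrow> bool" where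
  "EG_findim n E \<longleftrightarrow> (\<exists>B. finite B \<and> B \<subseteq> EG E \<and>
       (\<forall>Q\<in>EG E. \<exists>P\<in>nc.span B. Q - P \<in> FK_ideal n))"

definition transp :: "nat \<Rightarrow> nat \<Rightarrow> nat \<Rightarrow> nat" where
  "transp i j k = (if k = i then j else if k = j then i else k)"

definition act :: "gen \<Rightarrow> word \<Rightarrow> word" where
  "act g w = map (\<lambda>(a, b). (transp (fst g) (snd g) a, transp (fst g) (snd g) b)) w"

text \<open>Braided coproduct of a monomial, as a list of tensor terms L \<otimes> R (monomials):
  Delta(g w) = (g \<otimes> 1 + 1 \<otimes> g) Delta(w), with (1 \<otimes> g)(L \<otimes> R) = sigma_g(L) \<otimes> g R.\<close>
fun coprod :: "word \<Rightarrow> (word \<times> word) list" where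
  "coprod [] = [([], [])]"
| "coprod (g # w) = map (\<lambda>(L, R). (g # L, R)) (coprod w)
                    @ map (\<lambda>(L, R). (act g L, g # R)) (coprod w)"

text \<open>An element of the graded dual of E_n, given by its values phi on words: it must vanish on
  the ideal (so it is a functional on E_n) and be supported in finitely many degrees.\<close>
definition pairing :: "nc \<Rightarrow> nc \<Rightarrow> rat" where
  "pairing phi P = (\<Sum>w\<in>{w. P w \<noteq> 0}. phi w * P w)"

definition graded_dual_elem :: "nat \<Rightarrow> nc \<Rightarrow> bool" where
  "graded_dual_elem n phi \<longleftrightarrow> (\<forall>P\<in>FK_ideal n. pairing phi P = 0) \<and>
       (\<exists>D. \<forall>w. length w > D \<longrightarrow> phi w = 0)"

definition dual_act :: "nc \<Rightarrow> word \<Rightarrow> nc" where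
  "dual_act phi w = sum_list (map (\<lambda>(L, R). scl (phi L) (monom R)) (coprod w))"

end

theory Submission
  imports Defs
begin

text \<open>
  Let \<open>Q\<close> be a nonzero homogeneous element of \<open>E\<^sub>G\<close> with \<open>g Q = 0\<close> for every generator \<open>g\<close> of
  \<open>E\<^sub>G\<close>. The set \<open>M\<close> of all \<open>phi * Q\<close> contains \<open>1\<close>. Expanding
  \<open>0 = \<Delta>(g Q) = (g \<otimes> 1 + 1 \<otimes> g) \<Delta>(Q)\<close> and applying a functional to the first factor shows that
  \<open>M\<close> is closed under left multiplication by \<open>g\<close>. As \<open>E\<^sub>G\<close> is a left coideal, \<open>M = E\<^sub>G\<close>.
  With \<open>Q\<close> a nonzero monomial of top degree this gives (b); its degree-\<open>d0\<close> part is (a), and (e)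
  holds because \<open>phi * p\<close> is a combination of subwords of \<open>p\<close>. It also shows that such a \<open>Q\<close> always
  has degree \<open>d0\<close>, so a nonzero multiple \<open>P Q\<close> with \<open>P\<close> of maximal degree lies in the top degree:
  this is (c). Then (d) follows from the nondegeneracy of the multiplication pairing into the top
  degree, and (f) from the fact that reversal is an involution of a one-dimensional space.
\<close>

section \<open>The free algebra\<close>

lemma scl_apply: "scl c P w = c * P w"
  by (simp add: scl_def)

text \<open>As simp rules these would unfold eta-expanded functions inside induction predicates.\<close>
declare plus_fun_apply [simp del] zero_fun_apply [simp del] minus_apply [simp del]
  uminus_apply [simp del]

lemmas nc_apply = plus_fun_apply zero_fun_apply minus_apply uminus_apply scl_apply

lemma monom_apply: "monom u w = (if w = u then 1 else 0)"
  by (simp add: monom_def)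

lemma ncmul_add_left: "ncmul (P + Q) R = ncmul P R + ncmul Q R"
  by (simp add: ncmul_def fun_eq_iff nc_apply algebra_simps sum.distrib)

lemma ncmul_add_right: "ncmul P (Q + R) = ncmul P Q + ncmul P R"
  by (simp add: ncmul_def fun_eq_iff nc_apply algebra_simps sum.distrib)

lemma ncmul_scl_left: "ncmul (scl c P) R = scl c (ncmul P R)"
  by (simp add: ncmul_def fun_eq_iff nc_apply algebra_simps sum_distrib_left)

lemma ncmul_scl_right: "ncmul P (scl c R) = scl c (ncmul P R)"
  by (simp add: ncmul_def fun_eq_iff nc_apply algebra_simps sum_distrib_left)

lemma ncmul_diff_left: "ncmul (P - Q) R = ncmul P R - ncmul Q R"
  by (simp add: ncmul_def fun_eq_iff nc_apply algebra_simps sum_subtractf)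

lemma ncmul_diff_right: "ncmul P (Q - R) = ncmul P Q - ncmul P R"
  by (simp add: ncmul_def fun_eq_iff nc_apply algebra_simps sum_subtractf)

lemma ncmul_zero_left [simp]: "ncmul 0 P = 0"
  by (simp add: ncmul_def fun_eq_iff nc_apply)

lemma ncmul_zero_right [simp]: "ncmul P 0 = 0"
  by (simp add: ncmul_def fun_eq_iff nc_apply)

lemma ncmul_Nil_left [simp]: "ncmul (monom []) P = P"
proof
  fix w
  have "ncmul (monom []) P w = (\<Sum>k\<in>{0..length w}. if k = 0 then P w else 0)"
    unfolding ncmul_def by (intro sum.cong) (auto simp: monom_apply)
  thus "ncmul (monom []) P w = P w"
    by simp
qed

text \<open>Only the split after the first letter contributes to the convolution, so left
  multiplication by a generator is a shift of coefficients. Inductions on words rest on this form of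
  the product.\<close>

lemma ncmul_gen:
  "ncmul (monom [g]) P w = (case w of [] \<Rightarrow> 0 | h # v \<Rightarrow> if h = g then P v else 0)"
proof (cases w)
  case Nil
  thus ?thesis by (simp add: ncmul_def monom_apply)
next
  case (Cons h v)
  have "ncmul (monom [g]) P w = (\<Sum>k\<in>{0..length w}. if k = 1 then (if h = g then P v else 0) else 0)"
    unfolding ncmul_def using Cons
    by (intro sum.cong) (auto simp: monom_apply take_Cons split: nat.splits)
  also have "\<dots> = (if h = g then P v else 0)"
    by (subst sum.delta) (auto simp: Cons)
  finally show ?thesis using Cons by simp
qed

text \<open>The empty split contributes nothing; shifting the other splits by one leaves the
  convolution of \<open>P\<close> and \<open>Q\<close> at the tail of the word.
  \<open>ncmul_monom_assoc\<close> extends this letter by letter.\<close>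

lemma ncmul_gen_assoc: "ncmul (monom [g]) (ncmul P Q) = ncmul (ncmul (monom [g]) P) Q"
proof
  fix w
  show "ncmul (monom [g]) (ncmul P Q) w = ncmul (ncmul (monom [g]) P) Q w"
  proof (cases w)
    case Nil
    thus ?thesis by (simp add: ncmul_gen) (simp add: ncmul_def [of "ncmul _ _"] ncmul_gen)
  next
    case (Cons h v)
    have "ncmul (ncmul (monom [g]) P) Q w
        = (\<Sum>k\<in>{0..Suc (length v)}. ncmul (monom [g]) P (take k w) * Q (drop k w))"
      by (simp add: ncmul_def [of "ncmul _ _"] Cons)
    also have "\<dots> = (\<Sum>k\<in>{0..length v}. ncmul (monom [g]) P (take (Suc k) w) * Q (drop (Suc k) w))"
      by (subst sum.atLeast0_atMost_Suc_shift) (simp add: ncmul_gen)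
    also have "\<dots> = ncmul (monom [g]) (ncmul P Q) w"
      by (simp add: Cons ncmul_gen ncmul_def [of P Q])
    finally show ?thesis by simp
  qed
qed

lemma ncmul_gen_monom [simp]: "ncmul (monom [g]) (monom w) = monom (g # w)"
  by (auto simp: fun_eq_iff nc_apply ncmul_gen monom_apply split: list.splits)

lemma ncmul_monom_assoc: "ncmul (monom u) (ncmul P Q) = ncmul (ncmul (monom u) P) Q"
proof (induction u)
  case (Cons g u)
  have eq: "ncmul (monom (g # u)) R = ncmul (monom [g]) (ncmul (monom u) R)" for R
    by (simp only: ncmul_gen_assoc ncmul_gen_monom)
  show ?case
    by (simp only: eq Cons.IH ncmul_gen_assoc)
qed simp

lemma ncmul_monom_Cons: "ncmul (monom (g # u)) P = ncmul (monom [g]) (ncmul (monom u) P)"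
  by (simp add: ncmul_monom_assoc)

lemma ncmul_monom_monom [simp]: "ncmul (monom u) (monom v) = monom (u @ v)"
proof (induction u)
  case (Cons g u)
  show ?case by (subst ncmul_monom_Cons) (simp add: Cons.IH)
qed simp

lemma monom_in_EG: "set w \<subseteq> E \<Longrightarrow> monom w \<in> EG E"
  unfolding EG_def by (rule nc.span_base) auto

lemma monom_in_EGd: "set w \<subseteq> E \<Longrightarrow> length w = d \<Longrightarrow> monom w \<in> EGd E d"
  unfolding EGd_def by (rule nc.span_base) auto

text \<open>Carrying membership in the span through \<open>nc.span_induct_alt\<close> keeps it
  available for the remaining sum \<open>Q\<close>. Rules such as \<open>pairing_add\<close> ask for
  it as a witness of finite support.\<close>

lemma span_induct_mem [consumes 1, case_names zero add]:
  assumes "P \<in> nc.span S"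
    and "A 0"
    and "\<And>c m Q. m \<in> S \<Longrightarrow> Q \<in> nc.span S \<Longrightarrow> A Q \<Longrightarrow> A (scl c m + Q)"
  shows "A P"
proof -
  have "P \<in> nc.span S \<and> A P"
    using assms(1)
  proof (induction rule: nc.span_induct_alt)
    case base
    show ?case using assms(2) by (rule conjI [OF nc.span_zero])
  next
    case (step c m Q)
    have "scl c m + Q \<in> nc.span S"
      using nc.span_add [OF nc.span_scale [OF nc.span_base [OF step(1)]]] step(2) by simp
    moreover have "A (scl c m + Q)"
      using step by (intro assms(3)) auto
    ultimately show ?case by (rule conjI)
  qed
  thus ?thesis by simp
qed

lemma EG_induct [consumes 1, case_names zero add]:
  assumes "P \<in> EG E"
    and "A 0"
    and "\<And>c w Q. set w \<subseteq> E \<Longrightarrow> Q \<in> EG E \<Longrightarrow> A Q \<Longrightarrow> A (scl c (monom w) + Q)"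
  shows "A P"
  using assms(1) unfolding EG_def
proof (induction rule: span_induct_mem)
  case zero
  show ?case by fact
next
  case (add c m Q)
  then obtain w where m: "m = monom w" and w: "set w \<subseteq> E" by blast
  have "A (scl c (monom w) + Q)"
    by (rule assms(3)) (use add w in \<open>simp_all add: EG_def\<close>)
  thus ?case unfolding m .
qed

lemma EGd_induct [consumes 1, case_names zero add]:
  assumes "P \<in> EGd E d"
    and "A 0"
    and "\<And>c w Q. set w \<subseteq> E \<Longrightarrow> length w = d \<Longrightarrow> Q \<in> EGd E d \<Longrightarrow> A Q
          \<Longrightarrow> A (scl c (monom w) + Q)"
  shows "A P"
  using assms(1) unfolding EGd_def
proof (induction rule: span_induct_mem)
  case zero
  show ?case by fact
next
  case (add c m Q)
  then obtain w where m: "m = monom w" and w: "set w \<subseteq> E" and l: "length w = d" by blast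
  have "A (scl c (monom w) + Q)"
    by (rule assms(3)) (use add w l in \<open>simp_all add: EGd_def\<close>)
  thus ?case unfolding m .
qed

lemma subspace_EG: "nc.subspace (EG E)"
  by (simp add: EG_def)

lemma subspace_EGd: "nc.subspace (EGd E d)"
  by (simp add: EGd_def)

lemma EG_mono: "E \<subseteq> F \<Longrightarrow> EG E \<subseteq> EG F"
  unfolding EG_def by (rule nc.span_mono) blast

lemma EGd_subset_EG: "EGd E d \<subseteq> EG E"
  unfolding EG_def EGd_def by (rule nc.span_mono) blast

lemma finite_support_EG: "P \<in> EG E \<Longrightarrow> finite {w. P w \<noteq> 0}"
proof (induction rule: EG_induct)
  case (add c w Q)
  have "{u. (scl c (monom w) + Q) u \<noteq> 0} \<subseteq> insert w {u. Q u \<noteq> 0}"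
    by (auto simp: monom_apply nc_apply)
  moreover have "finite (insert w {u. Q u \<noteq> 0})" using add by simp
  ultimately show ?case by (rule finite_subset)
qed (simp add: nc_apply)

text \<open>Cancellation can shrink the support of a sum, so additivity needs one common index set
  for both summands.\<close>

lemma pairing_superset:
  assumes "finite S" "{w. P w \<noteq> 0} \<subseteq> S"
  shows "pairing phi P = (\<Sum>w\<in>S. phi w * P w)"
  unfolding pairing_def by (rule sum.mono_neutral_left) (use assms in auto)

text \<open>Membership in \<open>EG E\<close> guarantees finite supports; a sum over an infinite
  support would be 0 by convention.\<close>

lemma pairing_add:
  assumes "P \<in> EG E" "Q \<in> EG E"
  shows "pairing phi (P + Q) = pairing phi P + pairing phi Q"
proof -
  let ?S = "{w. P w \<noteq> 0} \<union> {w. Q w \<noteq> 0}"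
  have fin: "finite ?S"
    using assms by (simp add: finite_support_EG)
  have "pairing phi (P + Q) = (\<Sum>w\<in>?S. phi w * (P + Q) w)"
    by (rule pairing_superset [OF fin]) (auto simp: nc_apply)
  also have "\<dots> = (\<Sum>w\<in>?S. phi w * P w) + (\<Sum>w\<in>?S. phi w * Q w)"
    by (simp add: nc_apply algebra_simps sum.distrib)
  also have "(\<Sum>w\<in>?S. phi w * P w) = pairing phi P"
    by (rule pairing_superset [OF fin, symmetric]) auto
  also have "(\<Sum>w\<in>?S. phi w * Q w) = pairing phi Q"
    by (rule pairing_superset [OF fin, symmetric]) auto
  finally show ?thesis .
qed

lemma pairing_scl: "pairing phi (scl c P) = c * pairing phi P"
proof (cases "c = 0")
  case False
  thus ?thesis by (simp add: pairing_def nc_apply sum_distrib_left algebra_simps)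
qed (simp add: pairing_def nc_apply)

lemma pairing_zero [simp]: "pairing phi 0 = 0"
  by (simp add: pairing_def nc_apply)

lemma pairing_monom [simp]: "pairing phi (monom w) = phi w"
  by (subst pairing_superset [of "{w}"]) (auto simp: monom_apply)

lemma pairing_diff:
  assumes "P \<in> EG E" "Q \<in> EG E"
  shows "pairing phi (P - Q) = pairing phi P - pairing phi Q"
proof -
  have "P - Q = P + scl (-1) Q" by (simp add: fun_eq_iff nc_apply)
  moreover have "scl (-1) Q \<in> EG E"
    using assms(2) by (intro nc.subspace_scale subspace_EG)
  ultimately show ?thesis
    using pairing_add [OF assms(1), of "scl (-1) Q" phi] pairing_scl [of phi "-1" Q]
    by simp
qed

lemma pairing_add_left:
  "pairing (\<lambda>w. phi w + psi w) P = pairing phi P + pairing psi P"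
  by (simp add: pairing_def algebra_simps sum.distrib)

lemma pairing_scl_left: "pairing (\<lambda>w. c * phi w) P = c * pairing phi P"
  by (simp add: pairing_def algebra_simps sum_distrib_left)

section \<open>The ideal of relations and its symmetries\<close>

lemma ideal_add: "P \<in> FK_ideal n \<Longrightarrow> Q \<in> FK_ideal n \<Longrightarrow> P + Q \<in> FK_ideal n"
  unfolding FK_ideal_def by (rule nc.span_add)

lemma ideal_diff: "P \<in> FK_ideal n \<Longrightarrow> Q \<in> FK_ideal n \<Longrightarrow> P - Q \<in> FK_ideal n"
  unfolding FK_ideal_def by (rule nc.span_diff)

lemma ideal_scl: "P \<in> FK_ideal n \<Longrightarrow> scl c P \<in> FK_ideal n"
  unfolding FK_ideal_def by (rule nc.span_scale)

lemma ideal_zero [simp]: "0 \<in> FK_ideal n"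
  unfolding FK_ideal_def by (rule nc.span_zero)

lemma ideal_uminus: "P \<in> FK_ideal n \<Longrightarrow> - P \<in> FK_ideal n"
  unfolding FK_ideal_def by (rule nc.span_neg)

lemma subspace_ideal: "nc.subspace (FK_ideal n)"
  unfolding FK_ideal_def by (rule nc.subspace_span)

lemma ideal_cong: "P - Q \<in> FK_ideal n \<Longrightarrow> P \<in> FK_ideal n \<longleftrightarrow> Q \<in> FK_ideal n"
  using ideal_add [of "P - Q" n Q] ideal_diff [of P n "P - Q"] by auto

lemma ideal_trans:
  "P - Q \<in> FK_ideal n \<Longrightarrow> Q - R \<in> FK_ideal n \<Longrightarrow> P - R \<in> FK_ideal n"
  using ideal_add [of "P - Q" n "Q - R"] by simp

lemma ideal_base:
  "\<lbrakk>set u \<subseteq> gens n; r \<in> FK_relators n; set v \<subseteq> gens n\<rbrakk>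
   \<Longrightarrow> ncmul (ncmul (monom u) r) (monom v) \<in> FK_ideal n"
  unfolding FK_ideal_def by (rule nc.span_base) blast

lemma ideal_induct [consumes 1, case_names zero add]:
  assumes "P \<in> FK_ideal n"
    and "A 0"
    and "\<And>c u r v Q. \<lbrakk>set u \<subseteq> gens n; r \<in> FK_relators n; set v \<subseteq> gens n; Q \<in> FK_ideal n; A Q\<rbrakk>
          \<Longrightarrow> A (scl c (ncmul (ncmul (monom u) r) (monom v)) + Q)"
  shows "A P"
  using assms(1) unfolding FK_ideal_def
proof (induction rule: span_induct_mem)
  case zero
  show ?case by fact
next
  case (add c m Q)
  then obtain u r v where m: "m = ncmul (ncmul (monom u) r) (monom v)"
    and urv: "set u \<subseteq> gens n" "r \<in> FK_relators n" "set v \<subseteq> gens n" by blast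
  have "A (scl c (ncmul (ncmul (monom u) r) (monom v)) + Q)"
    by (rule assms(3)) (use add urv in \<open>simp_all add: FK_ideal_def\<close>)
  thus ?case unfolding m .
qed

lemma gens_sym: "(i, j) \<in> gens n \<Longrightarrow> (j, i) \<in> gens n"
  by (auto simp: gens_def)

text \<open>Normal form for the case analyses below: products of \<open>x\<close> become monomials,
  and index bounds become membership in \<open>gens n\<close>.\<close>

lemma relator_cases [consumes 1, case_names antisym square commute triangle]:
  assumes "r \<in> FK_relators n"
  obtains (antisym) i j where "(i, j) \<in> gens n" "r = monom [(i, j)] + monom [(j, i)]"
  | (square) i j where "(i, j) \<in> gens n" "r = monom [(i, j), (i, j)]"
  | (commute) i j k l where "(i, j) \<in> gens n" "(k, l) \<in> gens n" "distinct [i, j, k, l]"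
      "r = monom [(i, j), (k, l)] - monom [(k, l), (i, j)]"
  | (triangle) i j k where "(i, j) \<in> gens n" "(j, k) \<in> gens n" "(k, i) \<in> gens n"
      "distinct [i, j, k]"
      "r = monom [(i, j), (j, k)] + monom [(j, k), (k, i)] + monom [(k, i), (i, j)]"
proof -
  from assms consider
      i j where "(i, j) \<in> gens n" "r = x i j + x j i"
    | i j where "(i, j) \<in> gens n" "r = ncmul (x i j) (x i j)"
    | i j k l where "i \<in> {1..n}" "j \<in> {1..n}" "k \<in> {1..n}" "l \<in> {1..n}" "distinct [i, j, k, l]"
        "r = ncmul (x i j) (x k l) - ncmul (x k l) (x i j)"
    | i j k where "i \<in> {1..n}" "j \<in> {1..n}" "k \<in> {1..n}" "distinct [i, j, k]"
        "r = ncmul (x i j) (x j k) + ncmul (x j k) (x k i) + ncmul (x k i) (x i j)"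
    unfolding FK_relators_def by blast
  thus ?thesis
  proof cases
    case 1
    thus ?thesis by (intro antisym) (auto simp: x_def)
  next
    case 2
    thus ?thesis by (intro square) (auto simp: x_def)
  next
    case (3 i j k l)
    thus ?thesis by (intro commute [of i j k l]) (auto simp: x_def gens_def)
  next
    case (4 i j k)
    thus ?thesis by (intro triangle [of i j k]) (auto simp: x_def gens_def)
  qed
qed

lemma antisym_in_relators:
  "(i, j) \<in> gens n \<Longrightarrow> monom [(i, j)] + monom [(j, i)] \<in> FK_relators n"
  unfolding FK_relators_def x_def by blast

lemma square_in_relators: "(i, j) \<in> gens n \<Longrightarrow> monom [(i, j), (i, j)] \<in> FK_relators n"
  unfolding FK_relators_def x_def by (simp only: ncmul_monom_monom append.simps) blast

lemma commute_in_relators: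
  "\<lbrakk>(i, j) \<in> gens n; (k, l) \<in> gens n; distinct [i, j, k, l]\<rbrakk>
   \<Longrightarrow> monom [(i, j), (k, l)] - monom [(k, l), (i, j)] \<in> FK_relators n"
  unfolding FK_relators_def x_def gens_def
  by (simp only: ncmul_monom_monom append.simps) blast

lemma triangle_in_relators:
  "\<lbrakk>(i, j) \<in> gens n; (j, k) \<in> gens n; (k, i) \<in> gens n; distinct [i, j, k]\<rbrakk>
   \<Longrightarrow> monom [(i, j), (j, k)] + monom [(j, k), (k, i)] + monom [(k, i), (i, j)] \<in> FK_relators n"
  unfolding FK_relators_def x_def gens_def
  by (simp only: ncmul_monom_monom append.simps) blast

lemma relator_in_EG: "r \<in> FK_relators n \<Longrightarrow> r \<in> EG (gens n)"
proof (induction rule: relator_cases)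
  case (antisym i j)
  thus ?case using gens_sym [of i j n]
    by (auto intro!: nc.subspace_add subspace_EG monom_in_EG)
next
  case (square i j)
  thus ?case by (auto intro!: monom_in_EG)
next
  case (commute i j k l)
  thus ?case by (auto intro!: nc.subspace_diff subspace_EG monom_in_EG)
next
  case (triangle i j k)
  thus ?case by (auto intro!: nc.subspace_add subspace_EG monom_in_EG)
qed

lemma ncmul_in_EG:
  assumes "P \<in> EG E" "Q \<in> EG E"
  shows "ncmul P Q \<in> EG E"
  using assms(1)
proof (induction rule: EG_induct)
  case (add c w P)
  have "ncmul (monom w) Q \<in> EG E"
    using assms(2)
  proof (induction rule: EG_induct)
    case (add c u Q)
    thus ?case using \<open>set w \<subseteq> E\<close>
      by (auto simp: ncmul_add_right ncmul_scl_right
               intro!: nc.subspace_add nc.subspace_scale subspace_EG monom_in_EG)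
  qed (simp add: nc.subspace_0 subspace_EG)
  thus ?case using add
    by (auto simp: ncmul_add_left ncmul_scl_left
             intro!: nc.subspace_add nc.subspace_scale subspace_EG)
qed (simp add: nc.subspace_0 subspace_EG)

lemma ideal_subset_EG: "FK_ideal n \<subseteq> EG (gens n)"
proof
  fix P assume "P \<in> FK_ideal n"
  thus "P \<in> EG (gens n)"
  proof (induction rule: ideal_induct)
    case (add c u r v Q)
    have "ncmul (ncmul (monom u) r) (monom v) \<in> EG (gens n)"
      using add by (simp add: ncmul_in_EG monom_in_EG relator_in_EG)
    thus ?case using add
      by (simp add: nc.subspace_add nc.subspace_scale subspace_EG)
  qed (simp add: nc.subspace_0 subspace_EG)
qed

lemma ideal_monom_mult:
  assumes "set p \<subseteq> gens n" "P \<in> FK_ideal n"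
  shows "ncmul (monom p) P \<in> FK_ideal n"
  using assms(2)
proof (induction rule: ideal_induct)
  case (add c u r v Q)
  have "ncmul (monom p) (ncmul (ncmul (monom u) r) (monom v))
      = ncmul (ncmul (monom (p @ u)) r) (monom v)"
    by (simp add: ncmul_monom_assoc)
  thus ?case using add assms(1)
    by (simp add: ncmul_add_right ncmul_scl_right ideal_add ideal_scl ideal_base)
qed simp

lemma ideal_mult_right:
  assumes "set u \<subseteq> gens n" "r \<in> FK_relators n" "Q \<in> EG (gens n)"
  shows "ncmul (ncmul (monom u) r) Q \<in> FK_ideal n"
  using assms(3)
proof (induction rule: EG_induct)
  case (add c w Q)
  thus ?case using assms
    by (simp add: ncmul_add_right ncmul_scl_right ideal_add ideal_scl ideal_base)
qed simp

section \<open>Transpositions acting on words and on the ideal\<close>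

lemma transp_invol [simp]: "transp i j (transp i j k) = k"
  by (simp add: transp_def)

lemma transp_inj [simp]: "transp i j k = transp i j l \<longleftrightarrow> k = l"
  by (metis transp_invol)

lemma transp_sym: "transp i j = transp j i"
  by (auto simp: transp_def fun_eq_iff nc_apply)

lemma act_Nil [simp]: "act g [] = []"
  by (simp add: act_def)

lemma act_Cons:
  "act g (h # w) = (transp (fst g) (snd g) (fst h), transp (fst g) (snd g) (snd h)) # act g w"
  by (simp add: act_def case_prod_unfold)

lemma length_act [simp]: "length (act g w) = length w"
  by (simp add: act_def)

lemma act_act [simp]: "act g (act g w) = w"
  by (simp add: act_def case_prod_unfold comp_def)

lemma act_eq_iff: "act g w = u \<longleftrightarrow> w = act g u"
  by auto

lemma transp_in_range: "i \<in> {1..n} \<Longrightarrow> j \<in> {1..n} \<Longrightarrow> k \<in> {1..n} \<Longrightarrow> transp i j k \<in> {1..n}"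
  by (simp add: transp_def)

lemma transp_in_gens:
  "(i, j) \<in> gens n \<Longrightarrow> (k, l) \<in> gens n \<Longrightarrow> (transp i j k, transp i j l) \<in> gens n"
  unfolding gens_def using transp_in_range [of i n j k] transp_in_range [of i n j l] by auto

lemma act_in_gens:
  assumes "g \<in> gens n" "set w \<subseteq> gens n"
  shows "set (act g w) \<subseteq> gens n"
  using assms(2)
proof (induction w)
  case (Cons h w)
  thus ?case
    using assms(1) transp_in_gens [of "fst g" "snd g" n "fst h" "snd h"] by (auto simp: act_Cons)
qed simp

text \<open>The algebra automorphism of a transposition is precomposition of coefficient functions:
  as \<open>act g\<close> is its own inverse, pulling back coefficients moves words by
  \<open>act g\<close> itself.\<close>

lemma monom_act: "monom w \<circ> act g = monom (act g w)"
  by (auto simp: fun_eq_iff nc_apply monom_apply act_eq_iff)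

lemma ncmul_act: "ncmul P Q \<circ> act g = ncmul (P \<circ> act g) (Q \<circ> act g)"
  by (simp add: fun_eq_iff nc_apply ncmul_def) (simp add: act_def take_map drop_map)

lemma add_comp: "(P + Q) \<circ> f = (P \<circ> f) + (Q \<circ> f)"
  by (simp add: fun_eq_iff nc_apply)

lemma diff_comp: "(P - Q) \<circ> f = (P \<circ> f) - (Q \<circ> f)"
  by (simp add: fun_eq_iff nc_apply)

lemma scl_comp: "scl c P \<circ> f = scl c (P \<circ> f)"
  by (simp add: fun_eq_iff nc_apply)

lemma zero_comp [simp]: "0 \<circ> f = 0"
  by (simp add: fun_eq_iff nc_apply)

text \<open>A transposition relabels indices injectively, so each relator goes to a relator of the
  same type.\<close>

lemma relator_act:
  assumes "g \<in> gens n" "r \<in> FK_relators n"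
  shows "r \<circ> act g \<in> FK_relators n"
proof -
  obtain a b where g: "g = (a, b)" by fastforce
  note T = transp_in_gens [OF assms(1) [unfolded g]]
  from assms(2) show ?thesis
  proof (cases rule: relator_cases)
    case (antisym i j)
    thus ?thesis by (auto simp: add_comp monom_act act_Cons g intro!: antisym_in_relators T)
  next
    case (square i j)
    thus ?thesis by (auto simp: monom_act act_Cons g intro!: square_in_relators T)
  next
    case (commute i j k l)
    thus ?thesis by (auto simp: diff_comp monom_act act_Cons g intro!: commute_in_relators T)
  next
    case (triangle i j k)
    thus ?thesis by (auto simp: add_comp monom_act act_Cons g intro!: triangle_in_relators T)
  qed
qed

lemma ideal_act:
  assumes "g \<in> gens n" "P \<in> FK_ideal n"
  shows "P \<circ> act g \<in> FK_ideal n"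
  using assms(2)
proof (induction rule: ideal_induct)
  case (add c u r v Q)
  have "ncmul (ncmul (monom u) r) (monom v) \<circ> act g \<in> FK_ideal n"
    using add assms(1)
    by (simp only: ncmul_act monom_act ideal_base act_in_gens relator_act)
  thus ?case using add
    by (simp add: add_comp scl_comp ideal_add ideal_scl del: comp_apply)
qed (simp del: comp_apply)

section \<open>Reversal of words and its descent to the quotient\<close>

lemma monom_rev: "monom w \<circ> rev = monom (rev w)"
  by (auto simp: fun_eq_iff nc_apply monom_apply)

lemma ncmul_rev: "ncmul P Q \<circ> rev = ncmul (Q \<circ> rev) (P \<circ> rev)"
proof
  fix w :: word
  have "(ncmul P Q \<circ> rev) w
      = (\<Sum>k\<in>{0..length w}. P (take k (rev w)) * Q (drop k (rev w)))"
    by (simp add: ncmul_def)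
  also have "\<dots> = (\<Sum>k\<in>{0..length w}. P (take (length w - k) (rev w)) * Q (drop (length w - k) (rev w)))"
    by (rule sum.reindex_bij_witness [of _ "\<lambda>k. length w - k" "\<lambda>k. length w - k"]) auto
  also have "\<dots> = ncmul (Q \<circ> rev) (P \<circ> rev) w"
    by (simp add: ncmul_def take_rev drop_rev mult.commute)
  finally show "(ncmul P Q \<circ> rev) w = ncmul (Q \<circ> rev) (P \<circ> rev) w" .
qed

lemma ideal_swap_gen:
  assumes "set u \<subseteq> gens n" "set v \<subseteq> gens n" "(i, j) \<in> gens n"
  shows "monom (u @ (i, j) # v) + monom (u @ (j, i) # v) \<in> FK_ideal n"
  using ideal_base [OF assms(1) antisym_in_relators [OF assms(3)] assms(2)]
  by (simp add: ncmul_add_left ncmul_add_right)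

text \<open>The two signs from antisymmetry cancel. \<open>ideal_rev\<close> uses this to repair the
  reversed triangle relator.\<close>

lemma ideal_swap_two_gens:
  assumes "set u \<subseteq> gens n" "set v \<subseteq> gens n" "(i, j) \<in> gens n" "(k, l) \<in> gens n"
  shows "monom (u @ (i, j) # (k, l) # v) - monom (u @ (j, i) # (l, k) # v) \<in> FK_ideal n"
proof -
  have "monom (u @ (i, j) # (k, l) # v) + monom (u @ (j, i) # (k, l) # v) \<in> FK_ideal n"
    using assms by (intro ideal_swap_gen) auto
  moreover have "monom ((u @ [(j, i)]) @ (k, l) # v) + monom ((u @ [(j, i)]) @ (l, k) # v) \<in> FK_ideal n"
    using assms by (intro ideal_swap_gen) (auto dest: gens_sym)
  ultimately show ?thesis
    using ideal_diff by fastforce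
qed

lemma ideal_rev:
  assumes "P \<in> FK_ideal n"
  shows "P \<circ> rev \<in> FK_ideal n"
  using assms
proof (induction rule: ideal_induct)
  case (add c u r v Q)
  define u' v' where "u' = rev u" and "v' = rev v"
  have uv: "set u' \<subseteq> gens n" "set v' \<subseteq> gens n"
    using add by (auto simp: u'_def v'_def)
  have "ncmul (monom v') (ncmul (r \<circ> rev) (monom u')) \<in> FK_ideal n"
    using \<open>r \<in> FK_relators n\<close>
  proof (cases rule: relator_cases)
    case (antisym i j)
    thus ?thesis using ideal_base [OF uv(2) add(2) uv(1)]
      by (simp add: add_comp monom_rev ncmul_monom_assoc)
  next
    case (square i j)
    thus ?thesis using ideal_base [OF uv(2) add(2) uv(1)]
      by (simp add: monom_rev ncmul_monom_assoc)
  next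
    case (commute i j k l)
    \<comment> \<open>Reversal changes the sign of a commutator.\<close>
    thus ?thesis using ideal_uminus [OF ideal_base [OF uv(2) add(2) uv(1)]]
      by (simp add: diff_comp monom_rev ncmul_monom_assoc ncmul_diff_left ncmul_diff_right)
  next
    case (triangle i j k)
    \<comment> \<open>The reversed relator is not literally a relator. Flipping both letters in each
      of its terms gives the triangle relator of \<open>k, j, i\<close>; the differences
      \<open>?A\<close>, \<open>?B\<close>, \<open>?C\<close> account for the flips.\<close>
    have t: "monom [(k, j), (j, i)] + monom [(j, i), (i, k)] + monom [(i, k), (k, j)] \<in> FK_relators n"
      using triangle by (intro triangle_in_relators) (auto dest: gens_sym)
    have "monom (v' @ (k, j) # (j, i) # u') + monom (v' @ (j, i) # (i, k) # u')
        + monom (v' @ (i, k) # (k, j) # u') \<in> FK_ideal n" (is "?S \<in> _")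
      using ideal_base [OF uv(2) t uv(1)]
      by (simp add: ncmul_add_left ncmul_add_right)
    moreover have
      "monom (v' @ (j, k) # (i, j) # u') - monom (v' @ (k, j) # (j, i) # u') \<in> FK_ideal n" (is "?A \<in> _")
      "monom (v' @ (k, i) # (j, k) # u') - monom (v' @ (i, k) # (k, j) # u') \<in> FK_ideal n" (is "?B \<in> _")
      "monom (v' @ (i, j) # (k, i) # u') - monom (v' @ (j, i) # (i, k) # u') \<in> FK_ideal n" (is "?C \<in> _")
      using triangle uv by (auto intro!: ideal_swap_two_gens)
    ultimately have "(?A + (?B + ?C)) + ?S \<in> FK_ideal n"
      by (simp only: ideal_add)
    thus ?thesis using triangle
      by (simp add: add_comp monom_rev ncmul_add_left ncmul_add_right algebra_simps)
  qed
  hence "ncmul (ncmul (monom u) r) (monom v) \<circ> rev \<in> FK_ideal n"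
    by (simp add: ncmul_rev monom_rev u'_def v'_def del: comp_apply)
  thus ?case using add
    by (simp add: add_comp scl_comp ideal_add ideal_scl del: comp_apply)
qed (simp del: comp_apply)

section \<open>Homogeneous components and the grading of the ideal\<close>

definition hcomp :: "nat \<Rightarrow> nc \<Rightarrow> nc" where
  "hcomp d P = (\<lambda>w. if length w = d then P w else 0)"

lemma hcomp_add: "hcomp d (P + Q) = hcomp d P + hcomp d Q"
  by (simp add: hcomp_def fun_eq_iff nc_apply)

lemma hcomp_diff: "hcomp d (P - Q) = hcomp d P - hcomp d Q"
  by (simp add: hcomp_def fun_eq_iff nc_apply)

lemma hcomp_scl: "hcomp d (scl c P) = scl c (hcomp d P)"
  by (simp add: hcomp_def fun_eq_iff nc_apply)

lemma hcomp_zero [simp]: "hcomp d 0 = 0"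
  by (simp add: hcomp_def fun_eq_iff nc_apply)

lemma hcomp_monom: "hcomp d (monom w) = (if length w = d then monom w else 0)"
  by (auto simp: hcomp_def fun_eq_iff nc_apply monom_apply)

lemma hcomp_ncmul_gen: "hcomp (Suc d) (ncmul (monom [g]) P) = ncmul (monom [g]) (hcomp d P)"
  by (auto simp: hcomp_def fun_eq_iff nc_apply ncmul_gen split: list.splits)

lemma hcomp_EGd: "P \<in> EGd E d \<Longrightarrow> hcomp e P = (if e = d then P else 0)"
  by (induction rule: EGd_induct) (auto simp: hcomp_add hcomp_scl hcomp_monom)

lemma hcomp_in_EGd: "P \<in> EG E \<Longrightarrow> hcomp d P \<in> EGd E d"
proof (induction rule: EG_induct)
  case (add c w Q)
  thus ?case
    by (auto simp: hcomp_add hcomp_scl hcomp_monom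
        intro!: nc.subspace_add nc.subspace_scale subspace_EGd monom_in_EGd)
qed (simp add: nc.subspace_0 subspace_EGd)

lemma ncmul_in_EGd:
  assumes "set p \<subseteq> E" "Q \<in> EGd E d"
  shows "ncmul (monom p) Q \<in> EGd E (length p + d)"
  using assms(2)
proof (induction rule: EGd_induct)
  case (add c w Q)
  thus ?case using assms(1)
    by (auto simp: ncmul_add_right ncmul_scl_right
        intro!: nc.subspace_add nc.subspace_scale subspace_EGd monom_in_EGd)
qed (simp add: nc.subspace_0 subspace_EGd)

lemma relator_homogeneous:
  assumes "r \<in> FK_relators n"
  obtains e where "r \<in> EGd (gens n) e"
  using assms
proof (cases rule: relator_cases)
  case (antisym i j)
  hence "r \<in> EGd (gens n) 1"
    using gens_sym [of i j n] by (auto intro!: nc.subspace_add subspace_EGd monom_in_EGd)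
  thus ?thesis by (rule that)
next
  case (square i j)
  hence "r \<in> EGd (gens n) 2"
    by (auto intro!: nc.subspace_add subspace_EGd monom_in_EGd)
  thus ?thesis by (rule that)
next
  case (commute i j k l)
  hence "r \<in> EGd (gens n) 2"
    by (auto intro!: nc.subspace_diff subspace_EGd monom_in_EGd)
  thus ?thesis by (rule that)
next
  case (triangle i j k)
  hence "r \<in> EGd (gens n) 2"
    by (auto intro!: nc.subspace_add subspace_EGd monom_in_EGd)
  thus ?thesis by (rule that)
qed

lemma ncmul_monom_in_EGd:
  assumes "P \<in> EGd E d" "set v \<subseteq> E"
  shows "ncmul P (monom v) \<in> EGd E (d + length v)"
  using assms(1)
proof (induction rule: EGd_induct)
  case (add c w Q)
  thus ?case using assms(2)
    by (auto simp: ncmul_add_left ncmul_scl_left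
        intro!: nc.subspace_add nc.subspace_scale subspace_EGd monom_in_EGd)
qed (simp add: nc.subspace_0 subspace_EGd)

text \<open>Relators are homogeneous, so each spanning element of the ideal is either kept or killed
  by \<open>hcomp d\<close>.\<close>

lemma hcomp_ideal:
  assumes "P \<in> FK_ideal n"
  shows "hcomp d P \<in> FK_ideal n"
  using assms
proof (induction rule: ideal_induct)
  case (add c u r v Q)
  obtain e where "r \<in> EGd (gens n) e"
    using relator_homogeneous add by blast
  hence "ncmul (ncmul (monom u) r) (monom v) \<in> EGd (gens n) (length u + e + length v)"
    using add by (intro ncmul_monom_in_EGd ncmul_in_EGd)
  hence "hcomp d (ncmul (ncmul (monom u) r) (monom v)) \<in> FK_ideal n"
    using add by (auto simp: hcomp_EGd ideal_base)
  thus ?case using add by (simp add: hcomp_add hcomp_scl ideal_add ideal_scl)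
qed simp

text \<open>Finite support bounds the degrees that occur, so \<open>P\<close> is a finite sum of its
  components.\<close>

lemma in_ideal_if_hcomp:
  assumes "P \<in> EG E" "\<And>d. hcomp d P \<in> FK_ideal n"
  shows "P \<in> FK_ideal n"
proof -
  have "\<exists>N. P = (\<Sum>d<N. hcomp d P)"
  proof -
    have "finite (length ` {w. P w \<noteq> 0})"
      using finite_support_EG [OF assms(1)] by simp
    then obtain N where N: "\<forall>k\<in>length ` {w. P w \<noteq> 0}. k < N"
      using finite_nat_set_iff_bounded by blast
    have apply_sum: "(\<Sum>d<M. hcomp d P) w = (\<Sum>d<M. hcomp d P w)" for M w
      by (induction M) (auto simp: nc_apply)
    have "P w = (\<Sum>d<N. hcomp d P) w" for w
    proof -
      have "(\<Sum>d<N. hcomp d P w) = (if length w \<in> {..<N} then P w else 0)"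
        unfolding hcomp_def by (subst sum.delta') auto
      thus ?thesis using N by (auto simp: apply_sum)
    qed
    thus ?thesis by blast
  qed
  then obtain N where "P = (\<Sum>d<N. hcomp d P)" ..
  moreover have "(\<Sum>d<M. hcomp d P) \<in> FK_ideal n" for M
    by (intro nc.subspace_sum subspace_ideal assms(2))
  ultimately show ?thesis by metis
qed

section \<open>The braided coproduct and the action of the dual\<close>

lemma sum_list_ncmul_gen:
  "sum_list (map (\<lambda>z. ncmul (monom [g]) (f z)) zs) = ncmul (monom [g]) (sum_list (map f zs))"
  by (induction zs) (simp_all add: ncmul_add_right)

lemma dual_act_Nil [simp]: "dual_act phi [] = scl (phi []) (monom [])"
  by (simp add: dual_act_def)

text \<open>In the coproduct recursion, \<open>g \<otimes> 1\<close> feeds \<open>g\<close> to the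
  functional, while \<open>1 \<otimes> g\<close> twists the functional by \<open>act g\<close> and
  leaves \<open>g\<close> in the second factor. Nearly all facts on \<open>dual_act\<close> are
  inductions through this identity.\<close>

lemma dual_act_Cons:
  "dual_act phi (g # w) =
     dual_act (\<lambda>L. phi (g # L)) w + ncmul (monom [g]) (dual_act (\<lambda>L. phi (act g L)) w)"
  unfolding dual_act_def sum_list_ncmul_gen [symmetric]
  by (simp add: comp_def case_prod_unfold ncmul_scl_right)

text \<open>Prepared for the quadratic relators: the four terms record which of the two letters end
  up in the first tensor factor.\<close>

lemma dual_act_Cons_Cons:
  "dual_act phi (g # h # v) =
     dual_act (\<lambda>L. phi (g # h # L)) v
     + ncmul (monom [h]) (dual_act (\<lambda>L. phi (g # act h L)) v)
     + ncmul (monom [g]) (dual_act (\<lambda>L. phi (act g (h # L))) v)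
     + ncmul (monom [g, h]) (dual_act (\<lambda>L. phi (act g (act h L))) v)"
proof -
  have "ncmul (monom [g]) (ncmul (monom [h]) Q) = ncmul (monom [g, h]) Q" for Q
    by (simp add: ncmul_monom_assoc)
  thus ?thesis by (simp add: dual_act_Cons ncmul_add_right add.assoc)
qed

lemma dual_act_add: "dual_act (\<lambda>L. phi L + psi L) w = dual_act phi w + dual_act psi w"
  by (induction w arbitrary: phi psi)
     (simp_all add: dual_act_Cons ncmul_add_right nc.scale_left_distrib)

lemma dual_act_scl: "dual_act (\<lambda>L. c * phi L) w = scl c (dual_act phi w)"
  by (induction w arbitrary: phi)
     (simp_all add: dual_act_Cons ncmul_scl_right nc.scale_right_distrib)

text \<open>The first tensor factors in \<open>coprod w\<close> are words over \<open>gens n\<close>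
  no longer than \<open>w\<close>, since \<open>act g\<close> preserves both alphabet and
  length.\<close>

lemma dual_act_zero:
  assumes "set w \<subseteq> gens n"
    and "\<And>L. set L \<subseteq> gens n \<Longrightarrow> length L \<le> length w \<Longrightarrow> phi L = 0"
  shows "dual_act phi w = 0"
  using assms
proof (induction w arbitrary: phi)
  case (Cons g w)
  have "dual_act (\<lambda>L. phi (g # L)) w = 0"
    using Cons.prems by (intro Cons.IH) auto
  moreover have "dual_act (\<lambda>L. phi (act g L)) w = 0"
    using Cons.prems by (intro Cons.IH) (auto simp: act_in_gens)
  ultimately show ?case by (simp add: dual_act_Cons)
qed simp

text \<open>The only first tensor factor of full length is \<open>w\<close> itself, and it is paired
  with the empty word.\<close>

lemma dual_act_top:
  assumes "set w \<subseteq> gens n" "\<And>L. length L < length w \<Longrightarrow> phi L = 0"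
  shows "dual_act phi w = scl (phi w) (monom [])"
  using assms
proof (induction w arbitrary: phi)
  case (Cons g w)
  have "dual_act (\<lambda>L. phi (g # L)) w = scl (phi (g # w)) (monom [])"
    using Cons.prems by (intro Cons.IH) auto
  moreover have "dual_act (\<lambda>L. phi (act g L)) w = 0"
    using Cons.prems by (intro dual_act_zero [of _ n]) auto
  ultimately show ?case by (simp add: dual_act_Cons)
qed simp

text \<open>The left coideal property of the subalgebra: the braiding moves only first tensor
  factors, so the letters of second factors stay in \<open>E\<close>.\<close>

lemma dual_act_in_EG: "set w \<subseteq> E \<Longrightarrow> dual_act phi w \<in> EG E"
proof (induction w arbitrary: phi)
  case Nil
  thus ?case by (simp add: nc.subspace_scale subspace_EG monom_in_EG)
next
  case (Cons g w)
  thus ?case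
    by (simp add: dual_act_Cons nc.subspace_add subspace_EG ncmul_in_EG monom_in_EG)
qed

text \<open>Second tensor factors are never twisted, hence are genuine subwords of \<open>w\<close>.
  This is the source of (e).\<close>

lemma dual_act_in_span_subwords:
  "dual_act phi w \<in> nc.span {monom (nths w S) | S. S \<subseteq> {0..<length w}}"
proof -
  have "dual_act phi w \<in> nc.span (range (\<lambda>S. monom (nths w S)))"
  proof (induction w arbitrary: phi)
    case Nil
    have "monom [] \<in> range (\<lambda>S. monom (nths [] S))" by simp
    thus ?case by (simp add: nc.span_scale nc.span_base)
  next
    case (Cons g w)
    let ?V = "nc.span (range (\<lambda>S. monom (nths (g # w) S)))"
    have "range (\<lambda>S. monom (nths w S)) \<subseteq> range (\<lambda>S. monom (nths (g # w) S))"
    proof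
      fix m assume "m \<in> range (\<lambda>S. monom (nths w S))"
      then obtain S where "m = monom (nths w S)" by blast
      \<comment> \<open>Shifting the positions by one omits the new letter \<open>g\<close>;
        inserting position 0 as well, as done below, selects it.\<close>
      also have "nths w S = nths (g # w) (Suc ` S)"
        by (simp add: nths_Cons image_iff)
      finally show "m \<in> range (\<lambda>S. monom (nths (g # w) S))" by blast
    qed
    hence "dual_act (\<lambda>L. phi (g # L)) w \<in> ?V"
      using Cons.IH nc.span_mono by blast
    moreover have "ncmul (monom [g]) Q \<in> ?V"
      if "Q \<in> nc.span (range (\<lambda>S. monom (nths w S)))" for Q
      using that
    proof (induction rule: span_induct_mem)
      case zero
      show ?case by (simp add: nc.span_zero)
    next
      case (add c m Q)
      then obtain S where m: "m = monom (nths w S)" by blast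
      have "g # nths w S = nths (g # w) (insert 0 (Suc ` S))"
        by (simp add: nths_Cons image_iff)
      hence "ncmul (monom [g]) m \<in> ?V"
        unfolding m by (intro nc.span_base) (metis ncmul_gen_monom rangeI)
      thus ?case using add
        by (simp add: ncmul_add_right ncmul_scl_right nc.span_add nc.span_scale)
    qed
    ultimately show ?case
      using Cons.IH by (simp add: dual_act_Cons nc.span_add)
  qed
  \<comment> \<open>The induction allowed arbitrary position sets; positions beyond the word select
    nothing and can be cut off.\<close>
  moreover have "range (\<lambda>S. monom (nths w S)) \<subseteq> {monom (nths w S) | S. S \<subseteq> {0..<length w}}"
  proof
    fix m assume "m \<in> range (\<lambda>S. monom (nths w S))"
    then obtain S where "m = monom (nths w S)" by blast
    also have "nths w S = nths w (S \<inter> {0..<length w})"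
      unfolding nths_def
      by (intro arg_cong [where f = "map fst"] filter_cong) (auto dest: set_zip_rightD)
    finally show "m \<in> {monom (nths w S) | S. S \<subseteq> {0..<length w}}" by blast
  qed
  ultimately show ?thesis
    using nc.span_mono by blast
qed

text \<open>The action never raises the degree, and the only second tensor factor of full length is
  \<open>w\<close>, paired with the empty word.\<close>

lemma hcomp_dual_act:
  "length w \<le> e \<Longrightarrow> hcomp e (dual_act phi w) = (if length w = e then scl (phi []) (monom w) else 0)"
proof (induction w arbitrary: phi e)
  case Nil
  thus ?case by (simp add: hcomp_scl hcomp_monom)
next
  case (Cons g w)
  then obtain e' where e: "e = Suc e'" by (cases e) auto
  show ?case using Cons
    by (auto simp: e dual_act_Cons hcomp_add hcomp_ncmul_gen ncmul_scl_right)
qed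

text \<open>The linear extension of \<^const>\<open>dual_act\<close> in the word; only meaningful for finitely
  supported arguments.\<close>
definition dact :: "nc \<Rightarrow> nc \<Rightarrow> nc" where
  "dact phi P = (\<lambda>R. pairing (\<lambda>w. dual_act phi w R) P)"

lemma dact_monom [simp]: "dact phi (monom w) = dual_act phi w"
  by (simp add: dact_def)

lemma dact_zero [simp]: "dact phi 0 = 0"
  by (simp add: dact_def fun_eq_iff nc_apply)

lemma dact_add: "P \<in> EG E \<Longrightarrow> Q \<in> EG E \<Longrightarrow> dact phi (P + Q) = dact phi P + dact phi Q"
  by (simp add: dact_def fun_eq_iff nc_apply pairing_add)

lemma dact_diff: "P \<in> EG E \<Longrightarrow> Q \<in> EG E \<Longrightarrow> dact phi (P - Q) = dact phi P - dact phi Q"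
  by (simp add: dact_def fun_eq_iff nc_apply pairing_diff)

lemma dact_scl: "dact phi (scl c P) = scl c (dact phi P)"
  by (simp add: dact_def fun_eq_iff nc_apply pairing_scl)

lemma dact_step:
  assumes "set w \<subseteq> E" "Q \<in> EG E"
  shows "dact phi (scl c (monom w) + Q) = scl c (dual_act phi w) + dact phi Q"
  using assms
  by (subst dact_add [of _ E]) (simp_all add: dact_scl nc.subspace_scale subspace_EG monom_in_EG)

lemma dact_add_left: "dact (\<lambda>L. phi L + psi L) P = dact phi P + dact psi P"
  by (simp add: dact_def fun_eq_iff dual_act_add nc_apply pairing_add_left)

lemma dact_scl_left: "dact (\<lambda>L. c * phi L) P = scl c (dact phi P)"
  by (simp add: dact_def fun_eq_iff dual_act_scl nc_apply pairing_scl_left)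

text \<open>The skew Leibniz rule \<open>\<Delta>(g P) = (g \<otimes> 1 + 1 \<otimes> g) \<Delta>(P)\<close>, read on the second tensor factor.\<close>
lemma dact_gen_mult:
  assumes "P \<in> EG E"
  shows "dact phi (ncmul (monom [g]) P) =
     dact (\<lambda>L. phi (g # L)) P + ncmul (monom [g]) (dact (\<lambda>L. phi (act g L)) P)"
  using assms
proof (induction rule: EG_induct)
  case (add c w Q)
  have "dact phi (ncmul (monom [g]) (scl c (monom w) + Q))
      = scl c (dual_act phi (g # w)) + dact phi (ncmul (monom [g]) Q)"
    unfolding ncmul_add_right ncmul_scl_right ncmul_gen_monom
    using add by (intro dact_step [of _ "insert g E"] ncmul_in_EG monom_in_EG)
                 (auto intro: EG_mono [THEN subsetD])
  also have "\<dots> = (scl c (dual_act (\<lambda>L. phi (g # L)) w) + dact (\<lambda>L. phi (g # L)) Q)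
      + ncmul (monom [g]) (scl c (dual_act (\<lambda>L. phi (act g L)) w) + dact (\<lambda>L. phi (act g L)) Q)"
    by (simp add: add dual_act_Cons nc.scale_right_distrib ncmul_add_right ncmul_scl_right
        algebra_simps)
  finally show ?case using add by (simp add: dact_step)
qed simp

section \<open>Functionals that descend to the quotient algebra\<close>

definition vanishes_on_ideal :: "nat \<Rightarrow> nc \<Rightarrow> bool" where
  "vanishes_on_ideal n phi \<longleftrightarrow> (\<forall>P\<in>FK_ideal n. pairing phi P = 0)"

lemma graded_dual_elem_iff:
  "graded_dual_elem n phi \<longleftrightarrow> vanishes_on_ideal n phi \<and> (\<exists>D. \<forall>w. length w > D \<longrightarrow> phi w = 0)"
  by (simp add: graded_dual_elem_def vanishes_on_ideal_def)

lemma pairing_gen: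
  assumes "P \<in> EG E"
  shows "pairing phi (ncmul (monom [g]) P) = pairing (\<lambda>L. phi (g # L)) P"
  using assms
proof (induction rule: EG_induct)
  case (add c w Q)
  have "pairing phi (ncmul (monom [g]) (scl c (monom w) + Q))
      = pairing phi (scl c (monom (g # w))) + pairing phi (ncmul (monom [g]) Q)"
    unfolding ncmul_add_right ncmul_scl_right ncmul_gen_monom
    using add by (intro pairing_add [of _ "insert g E"] ncmul_in_EG monom_in_EG
                        nc.subspace_scale subspace_EG)
                 (auto intro: EG_mono [THEN subsetD])
  moreover have "pairing (\<lambda>L. phi (g # L)) (scl c (monom w) + Q)
      = pairing (\<lambda>L. phi (g # L)) (scl c (monom w)) + pairing (\<lambda>L. phi (g # L)) Q"
    using add by (intro pairing_add [of _ E] monom_in_EG nc.subspace_scale subspace_EG)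
  ultimately show ?case using add by (simp add: pairing_scl)
qed simp

lemma pairing_act: "pairing phi (P \<circ> act g) = pairing (\<lambda>L. phi (act g L)) P"
  unfolding pairing_def
  by (rule sum.reindex_bij_witness [of _ "act g" "act g"]) auto

text \<open>The ideal is closed under left multiplication by \<open>g\<close>. With
  \<open>vanishes_act\<close>, this keeps both functionals in the skew Leibniz rule
  \<open>dact_gen_mult\<close> on the quotient.\<close>

lemma vanishes_gen:
  assumes "vanishes_on_ideal n phi" "g \<in> gens n"
  shows "vanishes_on_ideal n (\<lambda>L. phi (g # L))"
  unfolding vanishes_on_ideal_def
proof
  fix P assume P: "P \<in> FK_ideal n"
  hence "pairing (\<lambda>L. phi (g # L)) P = pairing phi (ncmul (monom [g]) P)"
    using ideal_subset_EG by (intro pairing_gen [symmetric]) blast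
  also have "\<dots> = 0"
    using assms P ideal_monom_mult [of "[g]" n P] by (simp add: vanishes_on_ideal_def)
  finally show "pairing (\<lambda>L. phi (g # L)) P = 0" .
qed

lemma vanishes_act:
  assumes "vanishes_on_ideal n phi" "g \<in> gens n"
  shows "vanishes_on_ideal n (\<lambda>L. phi (act g L))"
  using assms ideal_act pairing_act unfolding vanishes_on_ideal_def by metis

lemma vanishes_antisym:
  assumes "vanishes_on_ideal n phi" "(i, j) \<in> gens n" "set L \<subseteq> gens n"
  shows "phi ((i, j) # L) + phi ((j, i) # L) = 0"
proof -
  have "monom ((i, j) # L) + monom ((j, i) # L) \<in> FK_ideal n"
    using ideal_swap_gen [of "[]" n L i j] assms by simp
  hence "pairing phi (monom ((i, j) # L) + monom ((j, i) # L)) = 0"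
    using assms(1) by (simp add: vanishes_on_ideal_def)
  thus ?thesis by (subst (asm) pairing_add [of _ UNIV]) (auto simp: monom_in_EG)
qed

lemma vanishes_square:
  assumes "vanishes_on_ideal n phi" "(i, j) \<in> gens n" "set L \<subseteq> gens n"
  shows "phi ((i, j) # (i, j) # L) = 0"
proof -
  have "monom ((i, j) # (i, j) # L) \<in> FK_ideal n"
    using ideal_base [of "[]" n _ L] square_in_relators assms by fastforce
  thus ?thesis
    using assms(1) by (metis pairing_monom vanishes_on_ideal_def)
qed

lemma vanishes_commute:
  assumes "vanishes_on_ideal n phi" "(i, j) \<in> gens n" "(k, l) \<in> gens n"
    "distinct [i, j, k, l]" "set L \<subseteq> gens n"
  shows "phi ((i, j) # (k, l) # L) - phi ((k, l) # (i, j) # L) = 0"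
proof -
  have "monom ((i, j) # (k, l) # L) - monom ((k, l) # (i, j) # L) \<in> FK_ideal n"
    using ideal_base [OF _ commute_in_relators [OF assms(2-4)] assms(5), of "[]"]
    by (simp add: ncmul_diff_left)
  hence "pairing phi (monom ((i, j) # (k, l) # L) - monom ((k, l) # (i, j) # L)) = 0"
    using assms(1) by (simp add: vanishes_on_ideal_def)
  thus ?thesis by (subst (asm) pairing_diff [of _ UNIV]) (auto simp: monom_in_EG)
qed

lemma vanishes_triangle:
  assumes "vanishes_on_ideal n phi" "(i, j) \<in> gens n" "(j, k) \<in> gens n" "(k, i) \<in> gens n"
    "distinct [i, j, k]" "set L \<subseteq> gens n"
  shows "phi ((i, j) # (j, k) # L) + phi ((j, k) # (k, i) # L) + phi ((k, i) # (i, j) # L) = 0"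
proof -
  let ?a = "monom ((i, j) # (j, k) # L)" and ?b = "monom ((j, k) # (k, i) # L)"
    and ?c = "monom ((k, i) # (i, j) # L)"
  have "?a + ?b + ?c \<in> FK_ideal n"
    using ideal_base [OF _ triangle_in_relators [OF assms(2-5)] assms(6), of "[]"]
    by (simp add: ncmul_add_left)
  hence "pairing phi (?a + ?b + ?c) = 0"
    using assms(1) by (simp add: vanishes_on_ideal_def)
  moreover have "pairing phi (?a + ?b + ?c) = pairing phi ?a + pairing phi ?b + pairing phi ?c"
    by (simp add: pairing_add [of _ UNIV] monom_in_EG nc.subspace_add subspace_EG)
  ultimately show ?thesis by simp
qed

lemma dual_act_zero_sum2:
  assumes "set v \<subseteq> gens n" "\<And>L. set L \<subseteq> gens n \<Longrightarrow> phi L + psi L = 0"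
  shows "dual_act phi v + dual_act psi v = 0"
  using dual_act_zero [OF assms(1), of "\<lambda>L. phi L + psi L"] assms(2) by (simp add: dual_act_add)

text \<open>Modulo the ideal, relators are primitive. Terms with the whole relator in the first
  factor are killed by \<open>phi\<close>, mixed terms cancel, and what remains is \<open>r\<close>
  times an element of the algebra.\<close>

lemma dact_relator:
  assumes phi: "vanishes_on_ideal n phi" and r: "r \<in> FK_relators n" and v: "set v \<subseteq> gens n"
  shows "dact phi (ncmul r (monom v)) \<in> FK_ideal n"
  using r
proof (cases rule: relator_cases)
  case (antisym i j)
  have "dact phi (ncmul r (monom v)) = dual_act phi ((i, j) # v) + dual_act phi ((j, i) # v)"
    using antisym(2) by (simp add: ncmul_add_left dact_add [of _ UNIV] monom_in_EG)
  also have "\<dots> = (dual_act (\<lambda>L. phi ((i, j) # L)) v + dual_act (\<lambda>L. phi ((j, i) # L)) v)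
      + ncmul r (dual_act (\<lambda>L. phi (act (i, j) L)) v)"
    \<comment> \<open>Both letters induce the same transposition, so the twisted functional is
      common and \<open>r\<close> factors out.\<close>
    by (simp add: antisym(2) dual_act_Cons ncmul_add_left act_def transp_sym [of j i])
  also have "dual_act (\<lambda>L. phi ((i, j) # L)) v + dual_act (\<lambda>L. phi ((j, i) # L)) v = 0"
    using vanishes_antisym [OF phi antisym(1)] v by (intro dual_act_zero_sum2)
  finally show ?thesis
    using ideal_mult_right [of "[]" n r] r v by (simp add: dual_act_in_EG)
next
  case (square i j)
  let ?g = "(i, j)"
  \<comment> \<open>A transposition reverses its own generator, so the two mixed terms cancel by
    antisymmetry.\<close>
  have act_g: "act ?g (?g # L) = (j, i) # act ?g L" for L
    using square(1) by (simp add: act_Cons transp_def gens_def)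
  have "dact phi (ncmul r (monom v)) = dual_act phi (?g # ?g # v)"
    using square(2) by simp
  also have "\<dots> = dual_act (\<lambda>L. phi (?g # ?g # L)) v
      + ncmul (monom [?g]) (dual_act (\<lambda>L. phi (?g # act ?g L)) v
                           + dual_act (\<lambda>L. phi ((j, i) # act ?g L)) v)
      + ncmul r (dual_act (\<lambda>L. phi (act ?g (act ?g L))) v)"
    by (simp add: square(2) dual_act_Cons_Cons ncmul_add_right act_g add.assoc)
  also have "dual_act (\<lambda>L. phi (?g # ?g # L)) v = 0"
    using vanishes_square [OF phi square(1)] v by (intro dual_act_zero [of _ n])
  also have "dual_act (\<lambda>L. phi (?g # act ?g L)) v + dual_act (\<lambda>L. phi ((j, i) # act ?g L)) v = 0"
    by (rule dual_act_zero_sum2 [OF v])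
       (intro vanishes_antisym [OF phi square(1)] act_in_gens [OF square(1)])
  finally show ?thesis
    using ideal_mult_right [of "[]" n r] r v by (simp add: dual_act_in_EG)
next
  case (commute i j k l)
  let ?g = "(i, j)" and ?h = "(k, l)"
  \<comment> \<open>Disjoint transpositions fix each other's generators, so the mixed terms of the
    two products agree and drop out of the difference.\<close>
  have act_g: "act ?g (?h # L) = ?h # act ?g L" and act_h: "act ?h (?g # L) = ?g # act ?h L" for L
    using commute(3) by (simp_all add: act_Cons transp_def)
  have act_gh: "act ?h (act ?g L) = act ?g (act ?h L)" for L
    using commute(3) by (auto simp: act_def transp_def)
  have "dact phi (ncmul r (monom v)) = dual_act phi (?g # ?h # v) - dual_act phi (?h # ?g # v)"
    using commute(4) by (simp add: ncmul_diff_left dact_diff [of _ UNIV] monom_in_EG)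
  also have "\<dots> = (dual_act (\<lambda>L. phi (?g # ?h # L)) v - dual_act (\<lambda>L. phi (?h # ?g # L)) v)
      + ncmul r (dual_act (\<lambda>L. phi (act ?g (act ?h L))) v)"
    by (simp add: commute(4) dual_act_Cons_Cons ncmul_diff_left act_g act_h act_gh)
  also have "dual_act (\<lambda>L. phi (?g # ?h # L)) v - dual_act (\<lambda>L. phi (?h # ?g # L)) v
      = dual_act (\<lambda>L. phi (?g # ?h # L)) v + dual_act (\<lambda>L. (- 1) * phi (?h # ?g # L)) v"
    unfolding dual_act_scl by simp
  also have "\<dots> = 0"
    using vanishes_commute [OF phi commute(1-3)] v by (intro dual_act_zero_sum2) simp_all
  finally show ?thesis
    using ideal_mult_right [of "[]" n r] r v by (simp add: dual_act_in_EG)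
next
  case (triangle i j k)
  let ?a = "(i, j)" and ?b = "(j, k)" and ?c = "(k, i)"
  \<comment> \<open>The twisted letter is always the reverse of the third edge of the triangle. In
    the mixed terms it meets that edge itself, and antisymmetry cancels the pair.\<close>
  have acts: "act ?a (?b # L) = (i, k) # act ?a L" "act ?b (?c # L) = (j, i) # act ?b L"
    "act ?c (?a # L) = (k, j) # act ?c L" for L
    using triangle(4) by (simp_all add: act_Cons transp_def)
  \<comment> \<open>The three products of two transpositions are one and the same 3-cycle, so the
    fully twisted terms combine into a multiple of \<open>r\<close>.\<close>
  have cyc: "act ?b (act ?c L) = act ?a (act ?b L)" "act ?c (act ?a L) = act ?a (act ?b L)" for L
    using triangle(4) by (auto simp: act_def transp_def)
  have "dact phi (ncmul r (monom v))
      = dual_act phi (?a # ?b # v) + dual_act phi (?b # ?c # v) + dual_act phi (?c # ?a # v)"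
    using triangle(5)
    by (simp add: ncmul_add_left dact_add [of _ UNIV] monom_in_EG nc.subspace_add subspace_EG)
  also have "\<dots> = (dual_act (\<lambda>L. phi (?a # ?b # L)) v + dual_act (\<lambda>L. phi (?b # ?c # L)) v
        + dual_act (\<lambda>L. phi (?c # ?a # L)) v)
      + ncmul (monom [?a]) (dual_act (\<lambda>L. phi (?c # act ?a L)) v
                           + dual_act (\<lambda>L. phi ((i, k) # act ?a L)) v)
      + ncmul (monom [?b]) (dual_act (\<lambda>L. phi (?a # act ?b L)) v
                           + dual_act (\<lambda>L. phi ((j, i) # act ?b L)) v)
      + ncmul (monom [?c]) (dual_act (\<lambda>L. phi (?b # act ?c L)) v
                           + dual_act (\<lambda>L. phi ((k, j) # act ?c L)) v)
      + ncmul r (dual_act (\<lambda>L. phi (act ?a (act ?b L))) v)"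
    by (simp add: triangle(5) dual_act_Cons_Cons ncmul_add_left ncmul_add_right acts cyc ac_simps)
  also have "dual_act (\<lambda>L. phi (?c # act ?a L)) v + dual_act (\<lambda>L. phi ((i, k) # act ?a L)) v = 0"
    by (rule dual_act_zero_sum2 [OF v])
       (intro vanishes_antisym [OF phi triangle(3)] act_in_gens [OF triangle(1)])
  also have "dual_act (\<lambda>L. phi (?a # act ?b L)) v + dual_act (\<lambda>L. phi ((j, i) # act ?b L)) v = 0"
    by (rule dual_act_zero_sum2 [OF v])
       (intro vanishes_antisym [OF phi triangle(1)] act_in_gens [OF triangle(2)])
  also have "dual_act (\<lambda>L. phi (?b # act ?c L)) v + dual_act (\<lambda>L. phi ((k, j) # act ?c L)) v = 0"
    by (rule dual_act_zero_sum2 [OF v])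
       (intro vanishes_antisym [OF phi triangle(2)] act_in_gens [OF triangle(3)])
  also have "dual_act (\<lambda>L. phi (?a # ?b # L)) v + dual_act (\<lambda>L. phi (?b # ?c # L)) v
        + dual_act (\<lambda>L. phi (?c # ?a # L)) v = 0"
    unfolding dual_act_add [symmetric]
    using vanishes_triangle [OF phi triangle(1-4)] v by (intro dual_act_zero [of _ n])
  finally show ?thesis
    using ideal_mult_right [of "[]" n r] r v by (simp add: dual_act_in_EG)
qed

text \<open>Well-definedness of the coproduct on the quotient algebra.\<close>
lemma dact_ideal:
  assumes "vanishes_on_ideal n phi" "P \<in> FK_ideal n"
  shows "dact phi P \<in> FK_ideal n"
  using assms(2)
proof (induction rule: ideal_induct)
  case (add c u r v Q)
  have inEG: "ncmul (ncmul (monom u) r) (monom v) \<in> EG (gens n)" if "set u \<subseteq> gens n" for u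
    using that add by (simp add: ncmul_in_EG monom_in_EG relator_in_EG)
  have "dact phi (ncmul (ncmul (monom u) r) (monom v)) \<in> FK_ideal n"
    \<comment> \<open>The functional must vary in the induction: each letter peeled off
      \<open>u\<close> replaces \<open>phi\<close> by two others that also vanish on the
      ideal.\<close>
    using assms(1) \<open>set u \<subseteq> gens n\<close>
  proof (induction u arbitrary: phi)
    case Nil
    thus ?case using add by (simp add: dact_relator)
  next
    case (Cons g u)
    have eq: "ncmul (ncmul (monom (g # u)) r) (monom v)
        = ncmul (monom [g]) (ncmul (ncmul (monom u) r) (monom v))"
      by (simp add: ncmul_monom_assoc)
    have "ncmul (monom [g]) (dact (\<lambda>L. phi (act g L)) (ncmul (ncmul (monom u) r) (monom v)))
        \<in> FK_ideal n"
      using Cons by (intro ideal_monom_mult Cons.IH vanishes_act) auto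
    moreover have "dact (\<lambda>L. phi (g # L)) (ncmul (ncmul (monom u) r) (monom v)) \<in> FK_ideal n"
      using Cons by (intro Cons.IH vanishes_gen) auto
    ultimately show ?case
      unfolding eq using Cons.prems by (subst dact_gen_mult [OF inEG]) (auto intro: ideal_add)
  qed
  moreover have "Q \<in> EG (gens n)"
    using add ideal_subset_EG by blast
  ultimately show ?case
    using add inEG [of u]
    by (simp add: dact_add [of _ "gens n"] dact_scl nc.subspace_scale subspace_EG ideal_add ideal_scl)
qed simp

section \<open>Linear algebra\<close>

text \<open>The functional is the coordinate at \<open>Q\<close> in a basis of the whole space that
  extends \<open>Q\<close> together with a basis of \<open>nc.span S\<close>.\<close>

lemma exists_separating_functional:
  assumes "Q \<notin> nc.span S"
  obtains f :: "nc \<Rightarrow> rat" where "\<And>P R. f (P + R) = f P + f R" "\<And>c P. f (scl c P) = c * f P"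
    "\<And>P. P \<in> nc.span S \<Longrightarrow> f P = 0" "f Q = 1"
proof -
  obtain B where B: "B \<subseteq> S" "nc.independent B" "S \<subseteq> nc.span B"
    using nc.maximal_independent_subset by blast
  have span_B: "nc.span S = nc.span B"
    using B by (meson nc.span_mono nc.span_minimal nc.subspace_span subset_antisym)
  have ind: "nc.independent (insert Q B)"
    using B assms span_B by (simp add: nc.independent_insertI)
  define C where "C = nc.extend_basis (insert Q B)"
  have C: "nc.independent C" "nc.span C = UNIV" "insert Q B \<subseteq> C"
    unfolding C_def
    by (rule nc.independent_extend_basis nc.span_extend_basis nc.extend_basis_superset, rule ind)+
  define f where "f P = nc.representation C P Q" for P
  have add: "f (P + R) = f P + f R" for P R
    unfolding f_def using C by (subst nc.representation_add) auto
  have scale: "f (scl c P) = c * f P" for c P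
    unfolding f_def using C by (subst nc.representation_scale) auto
  have "f P = 0" if "P \<in> nc.span B" for P
    using that
  proof (induction rule: span_induct_mem)
    case zero
    show ?case using scale [of 0 0] by simp
  next
    case (add c m P)
    have "m \<noteq> Q" using add assms span_B nc.span_base by blast
    hence "f m = 0" unfolding f_def using C add by (subst nc.representation_basis) auto
    thus ?case using add \<open>\<And>P R. f (P + R) = f P + f R\<close> scale by simp
  qed
  moreover have "f Q = 1"
    unfolding f_def using C by (subst nc.representation_basis) auto
  ultimately show ?thesis using that add scale span_B by blast
qed

text \<open>The ambient space is infinite-dimensional and an infinite basis would have
  \<open>card\<close> 0; the finite set \<open>F\<close> rules this out.\<close>

lemma dim_mono_finite:
  assumes "U \<subseteq> V" "V \<subseteq> nc.span F" "finite F"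
  shows "nc.dim U \<le> nc.dim V"
proof -
  obtain B where B: "B \<subseteq> V" "nc.independent B" "V \<subseteq> nc.span B" "card B = nc.dim V"
    using nc.basis_exists by blast
  moreover have "finite B"
    using nc.independent_span_bound [OF assms(3) B(2)] B(1) assms(2) by blast
  ultimately show ?thesis
    using nc.dim_le_card [of U B] assms(1) by auto
qed

text \<open>A basis of \<open>U\<close> is extended to one of \<open>V\<close>; the added vectors
  represent the quotient. Their number is the difference of dimensions by which \<open>dimEG\<close>
  is defined.\<close>

lemma quotient_basis:
  assumes "nc.subspace V" "nc.subspace U" "U \<subseteq> V" "V \<subseteq> nc.span F" "finite F"
  obtains T where "finite T" "T \<subseteq> V" "card T = nc.dim V - nc.dim U"
    "\<And>Q. Q \<in> V \<Longrightarrow> \<exists>P\<in>nc.span T. Q - P \<in> U"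
proof -
  obtain A where A: "A \<subseteq> U" "nc.independent A" "U \<subseteq> nc.span A"
    using nc.maximal_independent_subset by blast
  obtain B where B: "A \<subseteq> B" "B \<subseteq> V" "nc.independent B" "V \<subseteq> nc.span B"
    using nc.maximal_independent_subset_extend [of A V] A assms(3) by blast
  have fin: "finite B"
    using nc.independent_span_bound [OF assms(5) B(3)] B(2) assms(4) by blast
  have "card (B - A) = nc.dim V - nc.dim U"
    using nc.basis_card_eq_dim [of A U] nc.basis_card_eq_dim [of B V] A B fin
    by (simp add: card_Diff_subset finite_subset)
  moreover have "\<exists>P\<in>nc.span (B - A). Q - P \<in> U" if "Q \<in> V" for Q
  proof -
    have "Q \<in> nc.span ((B - A) \<union> A)"
      using that B by (simp add: Un_absorb2 subset_iff)
    then obtain P R where "P \<in> nc.span (B - A)" "R \<in> nc.span A" "Q = P + R"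
      unfolding nc.span_Un by blast
    moreover have "R \<in> U"
      using \<open>R \<in> nc.span A\<close> nc.span_minimal [OF A(1) assms(2)] by blast
    ultimately show ?thesis by (intro bexI [of _ P]) simp_all
  qed
  ultimately show ?thesis
    using that [of "B - A"] fin B by auto
qed

text \<open>A vector \<open>v\<close> of \<open>V\<close> with \<open>f v\<close> nonzero spans
  \<open>V\<close> together with the kernel, as subtracting \<open>f P / f v\<close> times
  \<open>v\<close> moves any \<open>P\<close> into the kernel.\<close>

lemma dim_le_dim_kernel_plus_one:
  fixes f :: "nc \<Rightarrow> rat"
  assumes "nc.subspace V" "V \<subseteq> nc.span F" "finite F"
    and add: "\<And>P R. f (P + R) = f P + f R" and scale: "\<And>c P. f (scl c P) = c * f P"
  shows "nc.dim V \<le> nc.dim (V \<inter> {P. f P = 0}) + 1"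
proof (cases "V \<subseteq> {P. f P = 0}")
  case True
  thus ?thesis by (simp add: Int_absorb2)
next
  case False
  then obtain v where v: "v \<in> V" "f v \<noteq> 0" by blast
  obtain B where B: "B \<subseteq> V \<inter> {P. f P = 0}" "nc.independent B" "V \<inter> {P. f P = 0} \<subseteq> nc.span B"
      "card B = nc.dim (V \<inter> {P. f P = 0})"
    using nc.basis_exists by blast
  have fin: "finite B"
    using nc.independent_span_bound [OF assms(3) B(2)] B(1) assms(2) by blast
  have "V \<subseteq> nc.span (insert v B)"
  proof
    fix P assume P: "P \<in> V"
    define c where "c = f P / f v"
    have eq: "P = (P + scl (- c) v) + scl c v"
      by (simp add: fun_eq_iff nc_apply)
    have "P + scl (- c) v \<in> V"
      by (rule nc.subspace_add [OF assms(1) P nc.subspace_scale [OF assms(1) v(1)]])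
    moreover have "f (P + scl (- c) v) = 0"
      using v unfolding add scale by (simp add: c_def)
    ultimately have "P + scl (- c) v \<in> nc.span B" using B(3) by blast
    hence "P + scl (- c) v \<in> nc.span (insert v B)"
      using nc.span_mono [of B "insert v B"] by blast
    moreover have "scl c v \<in> nc.span (insert v B)"
      by (simp add: nc.span_scale nc.span_base)
    ultimately show "P \<in> nc.span (insert v B)"
      using eq nc.span_add by metis
  qed
  hence "nc.dim V \<le> card (insert v B)"
    using fin by (intro nc.dim_le_card) auto
  also have "\<dots> \<le> card B + 1" using fin by (simp add: card_insert_if)
  finally show ?thesis using B(4) by simp
qed

lemma dim_le_dim_common_kernel:
  fixes f :: "'a \<Rightarrow> nc \<Rightarrow> rat"
  assumes "finite T" "nc.subspace V" "V \<subseteq> nc.span F" "finite F"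
    and add: "\<And>t P R. f t (P + R) = f t P + f t R"
    and scale: "\<And>t c P. f t (scl c P) = c * f t P"
  shows "nc.dim V \<le> nc.dim (V \<inter> {P. \<forall>t\<in>T. f t P = 0}) + card T"
  using assms(1)
proof (induction rule: finite_induct)
  case empty
  show ?case by simp
next
  case (insert t T)
  let ?K = "V \<inter> {P. \<forall>t\<in>T. f t P = 0}"
  have "f t 0 = 0" for t
    using scale [of t 0 0] by simp
  hence "nc.subspace ?K"
    using assms(2) by (auto simp: nc.subspace_def add scale)
  moreover have "?K \<subseteq> nc.span F" using assms(3) by blast
  ultimately have "nc.dim ?K \<le> nc.dim (?K \<inter> {P. f t P = 0}) + 1"
    using assms(4) add scale by (rule dim_le_dim_kernel_plus_one)
  moreover have "?K \<inter> {P. f t P = 0} = V \<inter> {P. \<forall>s\<in>insert t T. f s P = 0}" by auto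
  ultimately show ?case using insert by simp
qed

section \<open>Generation by the dual action\<close>

text \<open>A separating functional cut off to degree \<open>d\<close> still vanishes on the ideal,
  because the ideal is graded.\<close>

lemma exists_graded_dual_elem:
  assumes "Q \<in> EGd (gens n) d" "Q \<notin> FK_ideal n"
  obtains phi where "vanishes_on_ideal n phi" "\<And>w. length w \<noteq> d \<Longrightarrow> phi w = 0" "pairing phi Q = 1"
proof -
  obtain f :: "nc \<Rightarrow> rat" where f: "\<And>P R. f (P + R) = f P + f R" "\<And>c P. f (scl c P) = c * f P"
    "\<And>P. P \<in> FK_ideal n \<Longrightarrow> f P = 0" "f Q = 1"
    using exists_separating_functional assms(2) unfolding FK_ideal_def by blast
  define phi where "phi w = (if length w = d then f (monom w) else 0)" for w
  have f0: "f 0 = 0" using f(3) by simp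
  have pair: "pairing phi P = f (hcomp d P)" if "P \<in> EG (gens n)" for P
    using that
  proof (induction rule: EG_induct)
    case (add c w P)
    thus ?case
      by (simp add: pairing_add [of _ "gens n"] pairing_scl nc.subspace_scale subspace_EG
          monom_in_EG hcomp_add hcomp_scl hcomp_monom f f0 phi_def)
  qed (simp add: f0)
  have "vanishes_on_ideal n phi"
    unfolding vanishes_on_ideal_def
  proof
    fix P assume "P \<in> FK_ideal n"
    moreover from this have "P \<in> EG (gens n)" using ideal_subset_EG by blast
    ultimately show "pairing phi P = 0" by (simp add: pair hcomp_ideal f(3))
  qed
  moreover have "pairing phi Q = 1"
    using pair [OF subsetD [OF EGd_subset_EG assms(1)]] assms(1) f(4) by (simp add: hcomp_EGd)
  ultimately show ?thesis
    by (intro that [of phi]) (auto simp: phi_def)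
qed

lemma dact_top:
  assumes "Q \<in> EGd (gens n) d" "\<And>w. length w \<noteq> d \<Longrightarrow> phi w = 0"
  shows "dact phi Q = scl (pairing phi Q) (monom [])"
  using assms(1)
proof (induction rule: EGd_induct)
  case (add c w Q)
  have Q: "Q \<in> EG (gens n)" using add EGd_subset_EG by blast
  have "dual_act phi w = scl (phi w) (monom [])"
    using add assms(2) by (intro dual_act_top [of _ n]) auto
  thus ?case using add Q
    by (simp add: dact_step [of _ "gens n"] pairing_add [of _ "gens n"] pairing_scl
        nc.subspace_scale subspace_EG monom_in_EG nc.scale_left_distrib)
qed simp

lemma dact_generates:
  assumes E: "E \<subseteq> gens n" and Q: "Q \<in> EGd E d" "Q \<notin> FK_ideal n"
    and ann: "\<And>g. g \<in> E \<Longrightarrow> ncmul (monom [g]) Q \<in> FK_ideal n"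
    and R: "R \<in> EG E"
  shows "\<exists>phi. graded_dual_elem n phi \<and> R - dact phi Q \<in> FK_ideal n"
proof -
  have Qgens: "Q \<in> EGd (gens n) d"
    using Q(1) E unfolding EGd_def by (rule_tac nc.span_mono [THEN subsetD]) auto
  have QE: "Q \<in> EG (gens n)"
    using Qgens EGd_subset_EG by blast
  have word: "\<exists>phi. graded_dual_elem n phi \<and> monom w - dact phi Q \<in> FK_ideal n"
    if "set w \<subseteq> E" for w
    using that
  proof (induction w)
    case Nil
    \<comment> \<open>Concentrated in the degree of \<open>Q\<close>, this functional sees only the
      term \<open>Q \<otimes> 1\<close> of the coproduct and so produces the unit.\<close>
    obtain phi where phi: "vanishes_on_ideal n phi" "\<And>w. length w \<noteq> d \<Longrightarrow> phi w = 0"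
      "pairing phi Q = 1"
      using exists_graded_dual_elem [OF Qgens Q(2)] by blast
    have "graded_dual_elem n phi"
      unfolding graded_dual_elem_iff using phi by (metis less_irrefl)
    moreover have "monom [] - dact phi Q = 0"
      using dact_top [OF Qgens phi(2)] phi(3) by simp
    ultimately show ?case by (intro exI [of _ phi]) simp
  next
    case (Cons g w)
    then obtain phi where phi: "graded_dual_elem n phi" "monom w - dact phi Q \<in> FK_ideal n"
      by auto
    have g: "g \<in> gens n" "g \<in> E" using Cons.prems E by auto
    \<comment> \<open>Since \<open>act g\<close> is an involution, the twist in
      \<open>dact_gen_mult\<close> turns \<open>psi\<close> back into \<open>phi\<close>. As
      \<open>g\<close> annihilates \<open>Q\<close>, the functional that yields \<open>g # w\<close>
      is \<open>psi (g # L)\<close> with opposite sign.\<close>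
    define psi where "psi L = phi (act g L)" for L
    have psi: "vanishes_on_ideal n psi"
      unfolding psi_def using phi g by (intro vanishes_act) (auto simp: graded_dual_elem_iff)
    have "dact psi (ncmul (monom [g]) Q) \<in> FK_ideal n"
      using psi ann g by (intro dact_ideal) auto
    hence "dact (\<lambda>L. psi (g # L)) Q + ncmul (monom [g]) (dact phi Q) \<in> FK_ideal n"
      by (subst (asm) dact_gen_mult [OF QE]) (simp add: psi_def)
    moreover have "ncmul (monom [g]) (monom w - dact phi Q) \<in> FK_ideal n"
      using phi g by (intro ideal_monom_mult) auto
    hence "monom (g # w) - ncmul (monom [g]) (dact phi Q) \<in> FK_ideal n"
      by (simp add: ncmul_diff_right)
    ultimately have "(monom (g # w) - ncmul (monom [g]) (dact phi Q))
        + (dact (\<lambda>L. psi (g # L)) Q + ncmul (monom [g]) (dact phi Q)) \<in> FK_ideal n"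
      by (simp only: ideal_add)
    hence "monom (g # w) - dact (\<lambda>L. (- 1) * psi (g # L)) Q \<in> FK_ideal n"
      by (simp only: dact_scl_left) simp
    moreover have "vanishes_on_ideal n (\<lambda>L. (- 1) * psi (g # L))"
      using vanishes_gen [OF psi g(1)] unfolding vanishes_on_ideal_def
      by (simp only: pairing_scl_left) simp
    moreover obtain D where "\<And>w. length w > D \<Longrightarrow> phi w = 0"
      using phi(1) by (auto simp: graded_dual_elem_iff)
    hence "\<forall>L. length L > D \<longrightarrow> (- 1) * psi (g # L) = 0"
      by (simp add: psi_def)
    ultimately show ?case
      unfolding graded_dual_elem_iff by blast
  qed
  show ?thesis
    using R
  proof (induction rule: EG_induct)
    case zero
    \<comment> \<open>The zero functional is written as a product so that
      \<open>dact_scl_left\<close> applies to it.\<close>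
    have "graded_dual_elem n (\<lambda>L. 0 * 0)"
      by (simp add: graded_dual_elem_def pairing_def)
    moreover have "0 - dact (\<lambda>L. 0 * 0) Q \<in> FK_ideal n"
      by (subst dact_scl_left) simp
    ultimately show ?case by blast
  next
    case (add c w R)
    obtain phi where phi: "graded_dual_elem n phi" "monom w - dact phi Q \<in> FK_ideal n"
      using word add by blast
    obtain psi where psi: "graded_dual_elem n psi" "R - dact psi Q \<in> FK_ideal n"
      using add by blast
    let ?chi = "\<lambda>L. c * phi L + psi L"
    obtain D1 D2 where "\<And>w. length w > D1 \<Longrightarrow> phi w = 0" "\<And>w. length w > D2 \<Longrightarrow> psi w = 0"
      using phi(1) psi(1) by (auto simp: graded_dual_elem_def)
    hence "\<forall>w. length w > max D1 D2 \<longrightarrow> ?chi w = 0" by simp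
    moreover have "\<forall>P\<in>FK_ideal n. pairing ?chi P = 0"
      using phi(1) psi(1) by (simp add: graded_dual_elem_def pairing_add_left pairing_scl_left)
    ultimately have "graded_dual_elem n ?chi"
      unfolding graded_dual_elem_def by blast
    moreover have "scl c (monom w - dact phi Q) + (R - dact psi Q) \<in> FK_ideal n"
      using phi psi by (intro ideal_add ideal_scl)
    hence "scl c (monom w) + R - dact ?chi Q \<in> FK_ideal n"
      unfolding dact_add_left dact_scl_left by (simp add: nc.scale_right_diff_distrib algebra_simps)
    ultimately show ?case by blast
  qed
qed

section \<open>The top degree\<close>

lemma ncmul_EG_assoc:
  "P \<in> EG E \<Longrightarrow> ncmul (ncmul P Q) R = ncmul P (ncmul Q R)"
  by (induction rule: EG_induct)
     (simp_all add: ncmul_add_left ncmul_scl_left ncmul_monom_assoc)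

lemma ideal_mult_EG:
  assumes "P \<in> FK_ideal n" "Q \<in> EG (gens n)"
  shows "ncmul P Q \<in> FK_ideal n"
  using assms(1)
proof (induction rule: ideal_induct)
  case (add c u r v P)
  have "ncmul (ncmul (ncmul (monom u) r) (monom v)) Q
      = ncmul (ncmul (monom u) r) (ncmul (monom v) Q)"
    using add
    by (intro ncmul_EG_assoc [of _ "gens n"] ncmul_in_EG monom_in_EG relator_in_EG)
  moreover have "\<dots> \<in> FK_ideal n"
    using add assms(2) by (intro ideal_mult_right ncmul_in_EG monom_in_EG)
  ultimately show ?case using add
    by (simp add: ncmul_add_left ncmul_scl_left ideal_add ideal_scl)
qed simp

lemma finite_gens: "finite (gens n)"
  by (rule finite_subset [of _ "{1..n} \<times> {1..n}"]) (auto simp: gens_def)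

locale top_degree =
  fixes n :: nat and E :: "gen set" and d0 :: nat
  assumes E_gens: "E \<subseteq> gens n"
    and nonzero_top: "\<not> EGd E d0 \<subseteq> FK_ideal n"
    and zero_above: "\<And>d. d > d0 \<Longrightarrow> EGd E d \<subseteq> FK_ideal n"
begin

lemma EG_gens: "P \<in> EG E \<Longrightarrow> P \<in> EG (gens n)"
  using EG_mono [OF E_gens] by blast

lemma EGd_finite_span:
  obtains F where "finite F" "EGd E d \<subseteq> nc.span F"
proof
  show "finite {monom w | w. set w \<subseteq> E \<and> length w = d}"
    using finite_lists_length_eq [OF finite_subset [OF E_gens finite_gens]] by simp
  show "EGd E d \<subseteq> nc.span {monom w | w. set w \<subseteq> E \<and> length w = d}"
    by (simp add: EGd_def)
qed

lemma subspace_EGd_ideal: "nc.subspace (EGd E d \<inter> FK_ideal n)"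
  by (intro nc.subspace_inter subspace_EGd subspace_ideal)

lemma exists_top_word: "\<exists>w. set w \<subseteq> E \<and> length w = d0 \<and> monom w \<notin> FK_ideal n"
proof (rule ccontr)
  assume "\<not> ?thesis"
  hence "{monom w | w. set w \<subseteq> E \<and> length w = d0} \<subseteq> FK_ideal n" by blast
  hence "EGd E d0 \<subseteq> FK_ideal n"
    unfolding EGd_def by (rule nc.span_minimal [OF _ subspace_ideal])
  thus False using nonzero_top by simp
qed

text \<open>Every letter of \<open>E\<close> annihilates a top word, because the product has degree
  \<open>Suc d0\<close>. This is (b).\<close>

lemma top_word_generates:
  assumes "set w \<subseteq> E" "length w = d0" "monom w \<notin> FK_ideal n" "Q \<in> EG E"
  shows "\<exists>phi. graded_dual_elem n phi \<and> Q - dual_act phi w \<in> FK_ideal n"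
proof -
  have "ncmul (monom [g]) (monom w) \<in> FK_ideal n" if "g \<in> E" for g
    using that assms monom_in_EGd [of "g # w" E "Suc d0"] zero_above [of "Suc d0"] by auto
  from dact_generates [OF E_gens monom_in_EGd [OF assms(1,2)] assms(3) this assms(4)]
  show ?thesis by simp
qed

lemma top_spanned:
  assumes "set w \<subseteq> E" "length w = d0" "monom w \<notin> FK_ideal n" "Q \<in> EGd E d0"
  shows "\<exists>c. Q - scl c (monom w) \<in> FK_ideal n"
proof -
  obtain phi where "Q - dual_act phi w \<in> FK_ideal n"
    using top_word_generates [OF assms(1-3)] assms(4) EGd_subset_EG by blast
  hence "hcomp d0 (Q - dual_act phi w) \<in> FK_ideal n" by (rule hcomp_ideal)
  thus ?thesis
    using assms by (auto simp: hcomp_diff hcomp_EGd hcomp_dual_act)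
qed

text \<open>In a degree below \<open>d0\<close>, such a \<open>Q\<close> would generate a nonzero
  top word under the dual action, which cannot raise degrees.\<close>

lemma annihilated_degree:
  assumes "Q \<in> EGd E d" "Q \<notin> FK_ideal n" "\<And>g. g \<in> E \<Longrightarrow> ncmul (monom [g]) Q \<in> FK_ideal n"
  shows "d = d0"
proof (rule ccontr)
  assume "d \<noteq> d0"
  moreover have "\<not> d > d0" using zero_above assms(1,2) by blast
  ultimately have d: "d < d0" by simp
  obtain w where w: "set w \<subseteq> E" "length w = d0" "monom w \<notin> FK_ideal n"
    using exists_top_word by blast
  obtain phi where "monom w - dact phi Q \<in> FK_ideal n"
    using dact_generates [OF E_gens assms(1,2,3) monom_in_EG [OF w(1)]] by blast
  hence "hcomp d0 (monom w - dact phi Q) \<in> FK_ideal n" by (rule hcomp_ideal)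
  moreover have "hcomp d0 (dact phi Q) = 0"
    using assms(1)
  proof (induction rule: EGd_induct)
    case (add c w Q)
    have "Q \<in> EG E" using add EGd_subset_EG by blast
    thus ?case using add d by (simp add: dact_step hcomp_add hcomp_scl hcomp_dual_act)
  qed simp
  ultimately show False using w by (simp add: hcomp_diff hcomp_monom)
qed

lemma mult_to_top:
  assumes w0: "set w0 \<subseteq> E" "length w0 = d0" "monom w0 \<notin> FK_ideal n"
    and Q: "Q \<in> EG E" "Q \<notin> FK_ideal n"
  shows "\<exists>p c. set p \<subseteq> E \<and> c \<noteq> 0 \<and> ncmul (monom p) Q - scl c (monom w0) \<in> FK_ideal n"
proof -
  define A where "A p \<longleftrightarrow> set p \<subseteq> E \<and> ncmul (monom p) Q \<notin> FK_ideal n" for p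
  have bound: "length p \<le> d0" if "A p" for p
  proof (rule ccontr)
    assume len: "\<not> length p \<le> d0"
    have "ncmul (monom p) Q \<in> FK_ideal n"
      using Q(1)
    proof (induction rule: EG_induct)
      case (add c w Q)
      have "monom (p @ w) \<in> FK_ideal n"
        using len add that zero_above [of "length (p @ w)"] monom_in_EGd [of "p @ w" E]
        by (auto simp: A_def)
      thus ?case using add
        by (simp add: ncmul_add_right ncmul_scl_right ideal_add ideal_scl)
    qed simp
    thus False using that by (simp add: A_def)
  qed
  have "A []" using Q by (simp add: A_def)
  \<comment> \<open>Maximality of \<open>p\<close> makes every letter of \<open>E\<close> annihilate
    its product with \<open>Q\<close>. The bound passed to \<open>ex_has_greatest_nat\<close> is
    strict, hence \<open>Suc d0\<close>.\<close>
  then obtain p where p: "A p" and max: "\<And>q. A q \<Longrightarrow> length q \<le> length p"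
    using ex_has_greatest_nat [of A "[]" length "Suc d0"] bound by (auto simp: less_Suc_eq_le)
  define R where "R = ncmul (monom p) Q"
  have R: "R \<in> EG E" "R \<notin> FK_ideal n"
    using p Q by (auto simp: R_def A_def intro: ncmul_in_EG monom_in_EG)
  have ann: "ncmul (monom [g]) R \<in> FK_ideal n" if "g \<in> E" for g
  proof -
    have "\<not> A (g # p)" using max [of "g # p"] by auto
    thus ?thesis using p that by (simp add: A_def R_def ncmul_monom_assoc)
  qed
  \<comment> \<open>\<open>R\<close> may be inhomogeneous, but the letters annihilate each component
    separately, so only degree \<open>d0\<close> survives.\<close>
  have "hcomp d R \<in> FK_ideal n" if "d \<noteq> d0" for d
  proof (rule ccontr)
    assume "hcomp d R \<notin> FK_ideal n"
    moreover have "ncmul (monom [g]) (hcomp d R) \<in> FK_ideal n" if "g \<in> E" for g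
      using hcomp_ideal [OF ann [OF that], of "Suc d"] by (simp add: hcomp_ncmul_gen)
    ultimately show False
      using annihilated_degree [OF hcomp_in_EGd [OF R(1)]] that by blast
  qed
  hence "hcomp d (R - hcomp d0 R) \<in> FK_ideal n" for d
    using hcomp_EGd [OF hcomp_in_EGd [OF R(1)], of d d0] by (cases "d = d0") (auto simp: hcomp_diff)
  moreover have "R - hcomp d0 R \<in> EG E"
    using R(1) hcomp_in_EGd [OF R(1), of d0] EGd_subset_EG
    by (intro nc.subspace_diff subspace_EG) auto
  ultimately have "R - hcomp d0 R \<in> FK_ideal n"
    using in_ideal_if_hcomp by blast
  moreover obtain c where "hcomp d0 R - scl c (monom w0) \<in> FK_ideal n"
    using top_spanned [OF w0 hcomp_in_EGd [OF R(1)]] by blast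
  ultimately have c: "R - scl c (monom w0) \<in> FK_ideal n"
    by (rule ideal_trans)
  moreover have "c \<noteq> 0"
  proof
    assume "c = 0"
    thus False using c R(2) by simp
  qed
  ultimately show ?thesis
    using p unfolding R_def A_def by blast
qed

text \<open>Multiplication followed by a functional \<open>f\<close> with value 1 at
  \<open>monom w0\<close> pairs degrees \<open>d0 - d\<close> and \<open>d\<close>. The elements of
  degree \<open>d\<close> orthogonal to the representatives \<open>T\<close> lie in the ideal, so at
  most \<open>card T\<close> dimensions survive in the quotient.\<close>

lemma dimEG_le:
  assumes "d \<le> d0"
  shows "dimEG n E d \<le> dimEG n E (d0 - d)"
proof -
  obtain w0 where w0: "set w0 \<subseteq> E" "length w0 = d0" "monom w0 \<notin> FK_ideal n"
    using exists_top_word by blast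
  obtain f :: "nc \<Rightarrow> rat" where f: "\<And>P R. f (P + R) = f P + f R" "\<And>c P. f (scl c P) = c * f P"
    "\<And>P. P \<in> FK_ideal n \<Longrightarrow> f P = 0" "f (monom w0) = 1"
    using exists_separating_functional w0(3) unfolding FK_ideal_def by blast
  have f_cong: "f P = f R" if "P - R \<in> FK_ideal n" for P R
    using f(1) [of "P - R" R] f(3) [OF that] by simp
  obtain F' where F': "finite F'" "EGd E (d0 - d) \<subseteq> nc.span F'" by (rule EGd_finite_span)
  obtain F where F: "finite F" "EGd E d \<subseteq> nc.span F" by (rule EGd_finite_span)
  obtain T where T: "finite T" "T \<subseteq> EGd E (d0 - d)" "card T = dimEG n E (d0 - d)"
    "\<And>Q. Q \<in> EGd E (d0 - d) \<Longrightarrow> \<exists>P\<in>nc.span T. Q - P \<in> EGd E (d0 - d) \<inter> FK_ideal n"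
    using quotient_basis [OF subspace_EGd subspace_EGd_ideal _ F'(2,1)] unfolding dimEG_def by blast
  let ?K = "EGd E d \<inter> {P. \<forall>t\<in>T. f (ncmul t P) = 0}"
  have "P \<in> FK_ideal n" if P: "P \<in> ?K" for P
  proof (rule ccontr)
    assume "P \<notin> FK_ideal n"
    moreover have PE: "P \<in> EG E" using P EGd_subset_EG by blast
    ultimately obtain p c where p: "set p \<subseteq> E" and c: "c \<noteq> 0"
      and pc: "ncmul (monom p) P - scl c (monom w0) \<in> FK_ideal n"
      using mult_to_top [OF w0] by blast
    \<comment> \<open>\<open>mult_to_top\<close> does not fix the length of \<open>p\<close>. In any
      other degree, the degree-\<open>d0\<close> part of the relation would put
      \<open>monom w0\<close> in the ideal.\<close>
    have "length p + d = d0"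
    proof (rule ccontr)
      assume "length p + d \<noteq> d0"
      moreover have "ncmul (monom p) P \<in> EGd E (length p + d)"
        using P p by (intro ncmul_in_EGd) auto
      ultimately have "scl (- 1 / c) (hcomp d0 (ncmul (monom p) P - scl c (monom w0))) = monom w0"
        using c w0(2) by (simp add: hcomp_diff hcomp_EGd hcomp_scl hcomp_monom)
      thus False using ideal_scl [OF hcomp_ideal [OF pc]] w0(3) by metis
    qed
    hence "monom p \<in> EGd E (d0 - d)" using p by (intro monom_in_EGd) auto
    \<comment> \<open>Replacing \<open>p\<close> by a combination of \<open>T\<close> gives the
      contradiction: \<open>f\<close> takes the value \<open>c\<close> on one product and 0 on the
      other.\<close>
    then obtain s where s: "s \<in> nc.span T" "monom p - s \<in> FK_ideal n"
      using T(4) by blast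
    have "ncmul (monom p - s) P \<in> FK_ideal n"
      using s(2) EG_gens [OF PE] by (rule ideal_mult_EG)
    hence "f (ncmul (monom p) P) = f (ncmul s P)"
      by (intro f_cong) (simp add: ncmul_diff_left)
    moreover have "f (ncmul (monom p) P) = c"
      using f_cong [OF pc] f by simp
    moreover have "f (ncmul s P) = 0"
      using s(1)
    proof (induction rule: span_induct_mem)
      case (add c m Q)
      thus ?case using P by (simp add: ncmul_add_left ncmul_scl_left f)
    qed (simp add: f)
    ultimately show False using c by simp
  qed
  hence "nc.dim ?K \<le> nc.dim (EGd E d \<inter> FK_ideal n)"
    using F by (intro dim_mono_finite [of _ _ F]) auto
  moreover have "nc.dim (EGd E d) \<le> nc.dim ?K + card T"
    using F T(1) subspace_EGd
    by (intro dim_le_dim_common_kernel [where f = "\<lambda>t P. f (ncmul t P)"])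
       (auto simp: ncmul_add_right ncmul_scl_right f)
  ultimately show ?thesis
    using T(3) unfolding dimEG_def by linarith
qed

text \<open>Adjoining \<open>monom w0\<close> to a basis of the degree-\<open>d0\<close> part of the
  ideal in \<open>EGd E d0\<close> gives a basis of \<open>EGd E d0\<close>.\<close>

lemma dimEG_top: "dimEG n E d0 = 1"
proof -
  obtain w0 where w0: "set w0 \<subseteq> E" "length w0 = d0" "monom w0 \<notin> FK_ideal n"
    using exists_top_word by blast
  let ?V = "EGd E d0" and ?U = "EGd E d0 \<inter> FK_ideal n"
  obtain F where F: "finite F" "?V \<subseteq> nc.span F" by (rule EGd_finite_span)
  obtain B where B: "B \<subseteq> ?U" "nc.independent B" "?U \<subseteq> nc.span B" "card B = nc.dim ?U"
    using nc.basis_exists by blast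
  have fin: "finite B"
    using nc.independent_span_bound [OF F(1) B(2)] B(1) F(2) by blast
  have span_B: "nc.span B \<subseteq> ?U"
    using B(1) subspace_EGd_ideal by (rule nc.span_minimal)
  hence w0_B: "monom w0 \<notin> nc.span B" using w0 by blast
  have w0_V: "monom w0 \<in> ?V" using w0 by (intro monom_in_EGd)
  have "?V \<subseteq> nc.span (insert (monom w0) B)"
  proof
    fix Q assume Q: "Q \<in> ?V"
    then obtain c where "Q - scl c (monom w0) \<in> FK_ideal n"
      using top_spanned [OF w0] by blast
    moreover have "Q - scl c (monom w0) \<in> ?V"
      using Q w0_V by (intro nc.subspace_diff nc.subspace_scale subspace_EGd)
    ultimately have "Q - scl c (monom w0) \<in> nc.span B" using B(3) by blast
    thus "Q \<in> nc.span (insert (monom w0) B)"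
      using nc.span_breakdown_eq by blast
  qed
  hence "card (insert (monom w0) B) = nc.dim ?V"
    using B w0_V w0_B by (intro nc.basis_card_eq_dim nc.independent_insertI) auto
  moreover have "monom w0 \<notin> B" using w0_B nc.span_base by blast
  ultimately show ?thesis
    using B(4) fin unfolding dimEG_def by simp
qed

text \<open>Reversing twice the relation that makes \<open>rev w0\<close> a multiple
  \<open>c\<close> of \<open>w0\<close> forces \<open>c * c = 1\<close>.\<close>

lemma rev_top_word:
  assumes w0: "set w0 \<subseteq> E" "length w0 = d0" "monom w0 \<notin> FK_ideal n"
  shows "monom (rev w0) - monom w0 \<in> FK_ideal n \<or> monom (rev w0) + monom w0 \<in> FK_ideal n"
proof -
  have "monom (rev w0) \<in> EGd E d0" using w0 by (intro monom_in_EGd) auto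
  then obtain c where c: "monom (rev w0) - scl c (monom w0) \<in> FK_ideal n"
    using top_spanned [OF w0] by blast
  have "(monom (rev w0) - scl c (monom w0)) \<circ> rev \<in> FK_ideal n"
    using c by (rule ideal_rev)
  hence "monom w0 - scl c (monom (rev w0)) \<in> FK_ideal n"
    by (simp add: diff_comp scl_comp monom_rev del: comp_apply)
  moreover have "scl c (monom (rev w0) - scl c (monom w0)) \<in> FK_ideal n"
    using c by (rule ideal_scl)
  ultimately have "(monom w0 - scl c (monom (rev w0)))
      + scl c (monom (rev w0) - scl c (monom w0)) \<in> FK_ideal n"
    by (simp only: ideal_add)
  also have "(monom w0 - scl c (monom (rev w0))) + scl c (monom (rev w0) - scl c (monom w0))
      = scl (1 - c * c) (monom w0)"
    by (simp add: fun_eq_iff nc_apply algebra_simps)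
  finally have mem: "scl (1 - c * c) (monom w0) \<in> FK_ideal n" .
  have "1 - c * c = 0"
  proof (rule ccontr)
    assume "1 - c * c \<noteq> 0"
    thus False using ideal_scl [OF mem, of "1 / (1 - c * c)"] w0(3) by simp
  qed
  hence "c = 1 \<or> c = - 1" by (simp add: square_eq_1_iff)
  thus ?thesis using c by auto
qed

end

theorem mainTheorem1:
  fixes n :: nat and E :: "gen set" and d0 :: nat
  assumes "n \<ge> 1"
    and "simple_graph_on n E"
    and "EG_findim n E"
    and "\<not> EGd E d0 \<subseteq> FK_ideal n"
    and "\<forall>d>d0. EGd E d \<subseteq> FK_ideal n"
  shows "\<exists>w0. set w0 \<subseteq> E \<and> length w0 = d0
    \<comment> \<open>(a)\<close>
    \<and> dimEG n E d0 = 1 \<and> monom w0 \<notin> FK_ideal n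
    \<and> (\<forall>Q\<in>EGd E d0. \<exists>c. Q - scl c (monom w0) \<in> FK_ideal n)
    \<comment> \<open>(b)\<close>
    \<and> (\<forall>Q\<in>EG E. \<exists>phi. graded_dual_elem n phi \<and> Q - dual_act phi w0 \<in> FK_ideal n)
    \<comment> \<open>(c)\<close>
    \<and> (\<forall>Q\<in>EG E. Q \<notin> FK_ideal n \<longrightarrow>
         (\<exists>p c. set p \<subseteq> E \<and> c \<noteq> 0 \<and> ncmul (monom p) Q - scl c (monom w0) \<in> FK_ideal n))
    \<comment> \<open>(d)\<close>
    \<and> (\<forall>d\<le>d0. dimEG n E d = dimEG n E (d0 - d))
    \<comment> \<open>(e)\<close>
    \<and> (\<forall>p. set p \<subseteq> E \<and> length p = d0 \<and> monom p - monom w0 \<in> FK_ideal n \<longrightarrow>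
         (\<forall>Q\<in>EG E. \<exists>R\<in>nc.span {monom (nths p S) | S. S \<subseteq> {0..<d0}}. Q - R \<in> FK_ideal n))
    \<comment> \<open>(f)\<close>
    \<and> (monom (rev w0) - monom w0 \<in> FK_ideal n \<or> monom (rev w0) + monom w0 \<in> FK_ideal n)"
proof -
  interpret top_degree n E d0
    using assms by unfold_locales (auto simp: simple_graph_on_def)
  obtain w0 where w0: "set w0 \<subseteq> E" "length w0 = d0" "monom w0 \<notin> FK_ideal n"
    using exists_top_word by blast
  have dim_sym: "dimEG n E d = dimEG n E (d0 - d)" if "d \<le> d0" for d
    using dimEG_le [OF that] dimEG_le [of "d0 - d"] that by simp
  have subwords: "\<exists>R\<in>nc.span {monom (nths p S) | S. S \<subseteq> {0..<d0}}. Q - R \<in> FK_ideal n"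
    if p: "set p \<subseteq> E" "length p = d0" "monom p - monom w0 \<in> FK_ideal n" and Q: "Q \<in> EG E" for p Q
  proof -
    \<comment> \<open>Any word representing \<open>w0\<close> is itself a nonzero top word, so
      generation is applied to \<open>p\<close> directly and yields subwords of
      \<open>p\<close>.\<close>
    have "monom p \<notin> FK_ideal n" using ideal_cong [OF p(3)] w0(3) by simp
    then obtain phi where "Q - dual_act phi p \<in> FK_ideal n"
      using top_word_generates [OF p(1,2) _ Q] by blast
    thus ?thesis using dual_act_in_span_subwords [of phi p] p(2) by blast
  qed
  show ?thesis
    by (rule exI [of _ w0])
       (use w0 dimEG_top top_spanned [OF w0] top_word_generates [OF w0] mult_to_top [OF w0] dim_sym
          subwords rev_top_word [OF w0] in blast)
qed

end
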